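(* For $n>0$ and $k,p,r$ nonnegative integers, the number $a_{n,k,p,r}$ of involutive Baxter permutations with $2n$ non-fixed points, $2k$ descents not crossing the diagonal, $p$ fixed points, and $r$ descents crossing the diagonal is given by $$a_{n,k,p,r}=\frac{\displaystyle\binom{p+r}{r}\binom{n+p-1}{k}^2\binom{n}{t}}{n\,q^2(q+1)(k+1)(t+1)}\cdot\left|\begin{array}{ccc} q(q+1)&q(q-1)&s(s-1)\\ k(q+1)&(k+1)q&s(t+1)\\ k(k-1)&k(k+1)&t(t+1)\end{array}\right|,$$ where $q:=n+p-k$, $s:=n-k-r$, $t:=k+r$.
   Context: A permutation $\pi\in\mathfrak{S}_N$ is a Baxter permutation if it avoids the patterns $2\text{-}41\text{-}3$ and $3\text{-}14\text{-}2$, i.e. there are no indices $i<j<j+1<l$ with $\pi(j+1)<\pi(i)<\pi(l)<\pi(j)$, and no indices $i<j<j+1<l$ with $\pi(j)<\pi(l)<\pi(i)<\pi(j+1)$. It is involutive if $\pi^{-1}=\pi$. A descent of $\pi\in\mathfrak{S}_N$ is an integer $i\in\{1,\dots,N-1\}$ such that $\pi(i)>\pi(i+1)$. A descent $i$ is said to cross the diagonal if $\pi(i)>i$ and $\pi(i+1)<i+1$. The permutations counted have size $N=2n+p$. Vertical bars around the array denote the determinant. *)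

theory Defs
  imports "HOL-Analysis.Analysis" "HOL-Combinatorics.Permutations"
begin

text \<open>
  A permutation of size \<open>N\<close> is a function \<open>\<pi> :: nat \<Rightarrow> nat\<close> with
  \<open>\<pi> permutes {1..N}\<close>. Such a function is the identity outside \<open>{1..N}\<close>, so permutations
  of size \<open>N\<close> correspond one-to-one to these functions, and all conditions below
  restrict positions to \<open>{1..N}\<close>.
\<close>

definition contains_2_41_3 :: "nat \<Rightarrow> (nat \<Rightarrow> nat) \<Rightarrow> bool" where
  "contains_2_41_3 N \<pi> \<longleftrightarrow>
    (\<exists>i j l. 1 \<le> i \<and> i < j \<and> j + 1 < l \<and> l \<le> N \<and>
       \<pi> (j + 1) < \<pi> i \<and> \<pi> i < \<pi> l \<and> \<pi> l < \<pi> j)"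

definition contains_3_14_2 :: "nat \<Rightarrow> (nat \<Rightarrow> nat) \<Rightarrow> bool" where
  "contains_3_14_2 N \<pi> \<longleftrightarrow>
    (\<exists>i j l. 1 \<le> i \<and> i < j \<and> j + 1 < l \<and> l \<le> N \<and>
       \<pi> j < \<pi> l \<and> \<pi> l < \<pi> i \<and> \<pi> i < \<pi> (j + 1))"

definition baxter :: "nat \<Rightarrow> (nat \<Rightarrow> nat) \<Rightarrow> bool" where
  "baxter N \<pi> \<longleftrightarrow>
    \<pi> permutes {1..N} \<and> \<not> contains_2_41_3 N \<pi> \<and> \<not> contains_3_14_2 N \<pi>"

definition involutive_baxter :: "nat \<Rightarrow> (nat \<Rightarrow> nat) \<Rightarrow> bool" where
  "involutive_baxter N \<pi> \<longleftrightarrow> baxter N \<pi> \<and> inv \<pi> = \<pi>"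

definition descents :: "nat \<Rightarrow> (nat \<Rightarrow> nat) \<Rightarrow> nat set" where
  "descents N \<pi> = {i. 1 \<le> i \<and> i < N \<and> \<pi> i > \<pi> (i + 1)}"

definition crosses_diagonal :: "(nat \<Rightarrow> nat) \<Rightarrow> nat \<Rightarrow> bool" where
  "crosses_diagonal \<pi> i \<longleftrightarrow> \<pi> i > i \<and> \<pi> (i + 1) < i + 1"

definition crossing_descents :: "nat \<Rightarrow> (nat \<Rightarrow> nat) \<Rightarrow> nat set" where
  "crossing_descents N \<pi> = {i \<in> descents N \<pi>. crosses_diagonal \<pi> i}"

definition noncrossing_descents :: "nat \<Rightarrow> (nat \<Rightarrow> nat) \<Rightarrow> nat set" where
  "noncrossing_descents N \<pi> = {i \<in> descents N \<pi>. \<not> crosses_diagonal \<pi> i}"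

definition fixed_points :: "nat \<Rightarrow> (nat \<Rightarrow> nat) \<Rightarrow> nat set" where
  "fixed_points N \<pi> = {i \<in> {1..N}. \<pi> i = i}"

definition nonfixed_points :: "nat \<Rightarrow> (nat \<Rightarrow> nat) \<Rightarrow> nat set" where
  "nonfixed_points N \<pi> = {i \<in> {1..N}. \<pi> i \<noteq> i}"

definition involutive_baxter_set :: "nat \<Rightarrow> nat \<Rightarrow> nat \<Rightarrow> nat \<Rightarrow> (nat \<Rightarrow> nat) set" where
  "involutive_baxter_set n k p r =
    {\<pi>. involutive_baxter (2 * n + p) \<pi> \<and>
        card (nonfixed_points (2 * n + p) \<pi>) = 2 * n \<and>
        card (noncrossing_descents (2 * n + p) \<pi>) = 2 * k \<and>
        card (fixed_points (2 * n + p) \<pi>) = p \<and>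
        card (crossing_descents (2 * n + p) \<pi>) = r}"

definition num_involutive_baxter :: "nat \<Rightarrow> nat \<Rightarrow> nat \<Rightarrow> nat \<Rightarrow> nat" where
  "num_involutive_baxter n k p r = card (involutive_baxter_set n k p r)"

end

theory Submission
  imports Defs
begin

text \<open>
  Deleting the largest value \<open>N\<close> of an involutive Baxter permutation together with its partner
  \<open>i = \<pi> N\<close> leaves an involutive Baxter permutation. Conversely, to a permutation with
  \<open>a\<close> left-to-right maxima and \<open>b\<close> right-to-left maxima strictly above the diagonal one may
  append a fixed point, giving labels \<open>(a + 1, 0)\<close>, or insert a 2-cycle
    \<^item> at a left-to-right maximum, giving \<open>(j, b + 1)\<close> for \<open>1 \<le> j \<le> a\<close> and
      two new noncrossing descents,
    \<^item> after a right-to-left maximum above the diagonal, giving \<open>(a + 1, j)\<close> for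
      \<open>1 \<le> j \<le> b\<close> and no new descent,
    \<^item> at the end, giving \<open>(a + 1, 1)\<close> and one new crossing descent.

  So the permutations are counted by walks on the labels. The fixed points and crossing descents
  reset the second label; they can all be moved to the front at the price of a binomial
  coefficient. What remains is the number of triples of non-intersecting lattice paths, i.e. a
  \<open>3 \<times> 3\<close> determinant of binomial coefficients, which is verified to satisfy the recursion of
  the walks by Pascal's rule and multilinearity.
\<close>

section \<open>Deleting and inserting a 2-cycle\<close>

text \<open>Deleting \<open>N\<close> alone would destroy the symmetry, so its whole cycle goes, and
  the recursion drops by one or by two sizes. A forbidden pattern created by an insertion uses the
  new maximum as its \<open>4\<close> or the new last entry as its last letter; the sites are the
  places where an old entry could replace each of them.

  The obstacle to a direct count is that fixed points and crossing descents forget the second label.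
  Two observations remove it. If the second label is larger by one, the next right step has one more
  target, and that target keeps the label: it acts like a step that only raises the first label. And
  after a reset, the second label plus the number of crossing descents still to come is
  \<open>r\<close> for both kinds of reset, so the kinds are interchangeable; this is the origin of
  the factor \<open>(p + r) choose r\<close>.

  The path picture only suggests the determinant; the proof compares recursions. Their delicate
  boundary is second label 0, where no right step exists; there the symmetry of a row of Pascal's
  triangle makes the determinant degenerate as required.\<close>

definition up :: "nat \<Rightarrow> nat \<Rightarrow> nat" where
  "up i x = (if x < i then x else Suc x)"

definition down :: "nat \<Rightarrow> nat \<Rightarrow> nat" where
  "down i x = (if x < i then x else x - 1)"

text \<open>The new cycle pairs \<open>i\<close> with \<open>m + 2\<close>. Positions and values go
  through the same relabelling \<open>up i\<close>, which skips \<open>i\<close>; this is what keeps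
  an involution an involution.\<close>

definition insert_cycle :: "nat \<Rightarrow> nat \<Rightarrow> (nat \<Rightarrow> nat) \<Rightarrow> nat \<Rightarrow> nat" where
  "insert_cycle m i \<sigma> x =
     (if x = i then m + 2 else if x = m + 2 then i else up i (\<sigma> (down i x)))"

definition delete_cycle :: "nat \<Rightarrow> nat \<Rightarrow> (nat \<Rightarrow> nat) \<Rightarrow> nat \<Rightarrow> nat" where
  "delete_cycle m i \<pi> x = (if x \<le> m then down i (\<pi> (up i x)) else x)"

definition lr_max :: "nat \<Rightarrow> (nat \<Rightarrow> nat) \<Rightarrow> nat set" where
  "lr_max N \<pi> = {x \<in> {1..N}. \<forall>y\<in>{1..<x}. \<pi> y < \<pi> x}"

text \<open>Strictness keeps the last position out for an involution, so the site after such a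
  maximum never coincides with the end site \<open>m + 1\<close>.\<close>

definition rl_max :: "nat \<Rightarrow> (nat \<Rightarrow> nat) \<Rightarrow> nat set" where
  "rl_max N \<pi> = {x \<in> {1..N}. x < \<pi> x \<and> (\<forall>y\<in>{x<..N}. \<pi> y < \<pi> x)}"

lemma down_up [simp]: "down i (up i x) = x"
  by (auto simp: up_def down_def)

lemma up_down: "x \<noteq> i \<Longrightarrow> up i (down i x) = x"
  by (auto simp: up_def down_def)

lemma up_neq [simp]: "up i x \<noteq> i"
  by (auto simp: up_def)

lemma up_less_iff [simp]: "up i x < up i y \<longleftrightarrow> x < y"
  by (auto simp: up_def)

lemma up_eq_iff [simp]: "up i x = up i y \<longleftrightarrow> x = y"
  by (auto simp: up_def)

section \<open>Involutions and the correspondence between a permutation and its cycle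
  deletion\<close>

definition involution_on :: "nat \<Rightarrow> (nat \<Rightarrow> nat) \<Rightarrow> bool" where
  "involution_on N \<pi> \<longleftrightarrow> (\<forall>x. x \<notin> {1..N} \<longrightarrow> \<pi> x = x) \<and> (\<forall>x. \<pi> (\<pi> x) = x)"

lemma involution_on_iff: "involution_on N \<pi> \<longleftrightarrow> \<pi> permutes {1..N} \<and> inv \<pi> = \<pi>"
proof
  assume a: "involution_on N \<pi>"
  then have inv: "\<pi> (\<pi> x) = x" for x by (auto simp: involution_on_def)
  then have "\<pi> permutes {1..N}"
    using a unfolding permutes_def involution_on_def by metis
  moreover have "inv \<pi> = \<pi>"
    using inv by (intro inv_equality) auto
  ultimately show "\<pi> permutes {1..N} \<and> inv \<pi> = \<pi>" ..
next
  assume a: "\<pi> permutes {1..N} \<and> inv \<pi> = \<pi>"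
  then show "involution_on N \<pi>"
    unfolding involution_on_def by (metis permutes_inverses(1) permutes_not_in)
qed

lemma involutive_baxter_iff:
  "involutive_baxter N \<pi> \<longleftrightarrow>
     involution_on N \<pi> \<and> \<not> contains_2_41_3 N \<pi> \<and> \<not> contains_3_14_2 N \<pi>"
  by (auto simp: involutive_baxter_def baxter_def involution_on_iff)

lemma involution_on_involutive: "involution_on N \<pi> \<Longrightarrow> \<pi> (\<pi> x) = x"
  by (simp add: involution_on_def)

lemma involution_on_outside: "involution_on N \<pi> \<Longrightarrow> x = 0 \<or> N < x \<Longrightarrow> \<pi> x = x"
  by (auto simp: involution_on_def)

lemma involution_on_eq_iff: "involution_on N \<pi> \<Longrightarrow> \<pi> x = \<pi> y \<longleftrightarrow> x = y"
  by (metis involution_on_involutive)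

lemma involution_on_range:
  assumes "involution_on N \<pi>" "1 \<le> x" "x \<le> N"
  shows "1 \<le> \<pi> x" "\<pi> x \<le> N"
proof -
  show "1 \<le> \<pi> x"
    using assms by (metis involution_on_involutive involution_on_outside less_one not_le)
  show "\<pi> x \<le> N"
    using assms by (metis involution_on_involutive involution_on_outside not_le)
qed

lemma insert_cycle_simps [simp]:
  "insert_cycle m i \<sigma> i = m + 2"
  "i \<le> m + 1 \<Longrightarrow> insert_cycle m i \<sigma> (Suc (Suc m)) = i"
  by (auto simp: insert_cycle_def)

text \<open>The index \<open>m + 1\<close> is the one that \<open>up i\<close> sends to
  \<open>m + 2\<close>, a position taken by the new cycle.\<close>

lemma insert_cycle_up:
  "i \<le> m + 1 \<Longrightarrow> x \<noteq> m + 1 \<Longrightarrow> insert_cycle m i \<sigma> (up i x) = up i (\<sigma> x)"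
  by (auto simp: insert_cycle_def) (auto simp: up_def split: if_splits)

lemma insert_cycle_cases:
  assumes "1 \<le> i" "i \<le> m + 1" "1 \<le> x" "x \<le> m + 2"
  obtains "x = i" "insert_cycle m i \<sigma> x = m + 2"
  | "x = m + 2" "insert_cycle m i \<sigma> x = i"
  | y where "1 \<le> y" "y \<le> m" "x = up i y" "insert_cycle m i \<sigma> x = up i (\<sigma> y)"
proof -
  consider "x = i" | "x = m + 2" | "x \<noteq> i" "x \<noteq> m + 2" by blast
  then show ?thesis
  proof cases
    case 3
    have "1 \<le> down i x" "down i x \<le> m" "x = up i (down i x)"
      using 3 assms by (auto simp: down_def up_def)
    with that(3)[of "down i x"] 3 show ?thesis by (simp add: insert_cycle_def)
  qed (use that assms in auto)
qed

lemma involution_on_insert: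
  assumes s: "involution_on m \<sigma>" and i: "1 \<le> i" "i \<le> m + 1"
  shows "involution_on (m + 2) (insert_cycle m i \<sigma>)"
  unfolding involution_on_def
proof (intro conjI allI impI)
  fix x assume "x \<notin> {1..m + 2}"
  then consider "x = 0" | "x > m + 2" by fastforce
  then show "insert_cycle m i \<sigma> x = x"
  proof cases
    case 1
    then show ?thesis using s i by (auto simp: insert_cycle_def up_def down_def involution_on_outside)
  next
    case 2
    then have "down i x = x - 1" "\<sigma> (x - 1) = x - 1"
      using s i by (auto simp: down_def intro!: involution_on_outside[of m])
    with 2 i show ?thesis by (auto simp: insert_cycle_def up_def)
  qed
next
  fix x
  show "insert_cycle m i \<sigma> (insert_cycle m i \<sigma> x) = x"
  proof (cases "x = i \<or> x = m + 2")
    case False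
    then have x: "x = up i (down i x)" "down i x \<noteq> m + 1"
      using i by (auto simp: up_def down_def)
    then have "\<sigma> (down i x) \<noteq> m + 1"
      using involution_on_outside[OF s, of "m + 1"] involution_on_involutive[OF s, of "down i x"] by auto
    with x show ?thesis
      using i by (metis insert_cycle_up involution_on_involutive[OF s])
  qed (use i in auto)
qed

lemma involution_on_delete:
  assumes p: "involution_on (m + 2) \<pi>" and i: "\<pi> (m + 2) = i" "i \<le> m + 1"
  shows "1 \<le> i" "involution_on m (delete_cycle m i \<pi>)"
    "\<pi> = insert_cycle m i (delete_cycle m i \<pi>)"
proof -
  note eq = involution_on_eq_iff[OF p]
  note inv = involution_on_involutive[OF p]
  show i1: "1 \<le> i" using involution_on_range(1)[OF p, of "m + 2"] i by simp
  have pi: "\<pi> i = m + 2" using inv i by metis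
  have dom: "1 \<le> \<pi> (up i x) \<and> \<pi> (up i x) \<le> m + 1 \<and> \<pi> (up i x) \<noteq> i"
    if "1 \<le> x" "x \<le> m" for x
  proof -
    have u: "1 \<le> up i x" "up i x \<le> m + 1" using that by (auto simp: up_def)
    have "\<pi> (up i x) \<noteq> m + 2" using pi eq[of "up i x" i] by auto
    moreover have "\<pi> (up i x) \<noteq> i" using i eq[of "up i x" "m + 2"] u by auto
    ultimately show ?thesis using involution_on_range[OF p, of "up i x"] u by auto
  qed
  have rng: "1 \<le> delete_cycle m i \<pi> x \<and> delete_cycle m i \<pi> x \<le> m"
    if "1 \<le> x" "x \<le> m" for x
    using dom[OF that] that i1 i by (auto simp: delete_cycle_def down_def)
  show "involution_on m (delete_cycle m i \<pi>)"
    unfolding involution_on_def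
  proof (intro conjI allI impI)
    fix x assume "x \<notin> {1..m}"
    then show "delete_cycle m i \<pi> x = x"
      using i1 involution_on_outside[OF p, of 0]
      by (cases "x = 0") (auto simp: delete_cycle_def up_def down_def)
  next
    fix x
    show "delete_cycle m i \<pi> (delete_cycle m i \<pi> x) = x"
    proof (cases "1 \<le> x \<and> x \<le> m")
      case True
      then have "up i (delete_cycle m i \<pi> x) = \<pi> (up i x)"
        using dom[of x] by (auto simp: delete_cycle_def up_down)
      then show ?thesis using rng[of x] True inv by (simp add: delete_cycle_def)
    next
      case False
      then show ?thesis
        using i1 involution_on_outside[OF p, of 0]
        by (cases "x = 0") (auto simp: delete_cycle_def up_def down_def)
    qed
  qed
  show "\<pi> = insert_cycle m i (delete_cycle m i \<pi>)"
  proof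
    fix x
    consider "x = i" | "x = m + 2" | "x = 0" | "x > m + 2"
      | "1 \<le> x" "x \<le> m + 1" "x \<noteq> i" "x \<noteq> m + 2" by linarith
    then show "\<pi> x = insert_cycle m i (delete_cycle m i \<pi>) x"
    proof cases
      case 5
      then have "1 \<le> down i x" "down i x \<le> m" "up i (down i x) = x"
        using i i1 by (auto simp: down_def up_def)
      with 5 dom[of "down i x"] show ?thesis
        by (simp add: insert_cycle_def delete_cycle_def up_down)
    next
      case 3
      then show ?thesis using i1 involution_on_outside[OF p, of 0]
        by (auto simp: insert_cycle_def delete_cycle_def up_def down_def)
    next
      case 4
      then show ?thesis using i1 i involution_on_outside[OF p, of x]
        by (auto simp: insert_cycle_def delete_cycle_def up_def down_def)
    qed (use pi i in auto)
  qed
qed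

lemma delete_insert_cycle:
  assumes s: "involution_on m \<sigma>" and i: "1 \<le> i" "i \<le> m + 1"
  shows "delete_cycle m i (insert_cycle m i \<sigma>) = \<sigma>"
proof
  fix x
  show "delete_cycle m i (insert_cycle m i \<sigma>) x = \<sigma> x"
    using insert_cycle_up[of i m x \<sigma>] i involution_on_outside[OF s, of x]
    by (auto simp: delete_cycle_def)
qed

section \<open>Admissible insertion sites\<close>

lemma contains_2_41_3I:
  "\<lbrakk>1 \<le> x; x < j; j + 1 < l; l \<le> N; \<pi> (j + 1) < \<pi> x; \<pi> x < \<pi> l; \<pi> l < \<pi> j\<rbrakk>
    \<Longrightarrow> contains_2_41_3 N \<pi>"
  unfolding contains_2_41_3_def by blast

lemma contains_3_14_2I:
  "\<lbrakk>1 \<le> x; x < j; j + 1 < l; l \<le> N; \<pi> j < \<pi> l; \<pi> l < \<pi> x; \<pi> x < \<pi> (j + 1)\<rbrakk>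
    \<Longrightarrow> contains_3_14_2 N \<pi>"
  unfolding contains_3_14_2_def by blast

text \<open>The adjacent pair of an old occurrence stays adjacent unless the new column falls
  between its two entries, that is \<open>j + 1 = i\<close>. Then the new maximum stands directly
  before the old \<open>1\<close> and takes over as the \<open>4\<close>.\<close>

lemma contains_2_41_3_insert:
  assumes s: "involution_on m \<sigma>" and i: "1 \<le> i" "i \<le> m + 1"
    and c: "contains_2_41_3 m \<sigma>"
  shows "contains_2_41_3 (m + 2) (insert_cycle m i \<sigma>)"
proof -
  let ?p = "insert_cycle m i \<sigma>"
  from c obtain x j l where x: "1 \<le> x" "x < j" "j + 1 < l" "l \<le> m"
      "\<sigma> (j + 1) < \<sigma> x" "\<sigma> x < \<sigma> l" "\<sigma> l < \<sigma> j"
    unfolding contains_2_41_3_def by blast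
  have p: "?p (up i y) = up i (\<sigma> y)" if "y \<le> m" for y
    using that i by (intro insert_cycle_up) auto
  have v: "up i (\<sigma> y) < m + 2" if "1 \<le> y" "y \<le> m" for y
    using involution_on_range[OF s that] by (auto simp: up_def)
  have vals: "?p (up i (j + 1)) < ?p (up i x)" "?p (up i x) < ?p (up i l)" "?p (up i l) < ?p (up i j)"
    using x by (simp_all add: p)
  have lN: "up i l \<le> m + 2" "1 \<le> up i x" using x by (auto simp: up_def)
  show ?thesis
  proof (cases "j + 1 = i")
    case True
    then have u: "up i (j + 1) = i + 1" "up i x = x" "up i l = l + 1" using x by (auto simp: up_def)
    have "?p (up i l) < ?p i" using p[of l] v[of l] x by simp
    then show ?thesis
      unfolding contains_2_41_3_def
      using u x True vals by (intro exI[of _ x] exI[of _ i] exI[of _ "l + 1"]) auto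
  next
    case False
    then have "up i (j + 1) = up i j + 1" using x by (auto simp: up_def)
    moreover have "up i (j + 1) < up i l" "up i x < up i j" using x by simp_all
    ultimately show ?thesis
      unfolding contains_2_41_3_def using vals lN by metis
  qed
qed

lemma contains_3_14_2_insert:
  assumes s: "involution_on m \<sigma>" and i: "1 \<le> i" "i \<le> m + 1"
    and c: "contains_3_14_2 m \<sigma>"
  shows "contains_3_14_2 (m + 2) (insert_cycle m i \<sigma>)"
proof -
  let ?p = "insert_cycle m i \<sigma>"
  from c obtain x j l where x: "1 \<le> x" "x < j" "j + 1 < l" "l \<le> m"
      "\<sigma> j < \<sigma> l" "\<sigma> l < \<sigma> x" "\<sigma> x < \<sigma> (j + 1)"
    unfolding contains_3_14_2_def by blast
  have p: "?p (up i y) = up i (\<sigma> y)" if "y \<le> m" for y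
    using that i by (intro insert_cycle_up) auto
  have v: "up i (\<sigma> y) < m + 2" if "1 \<le> y" "y \<le> m" for y
    using involution_on_range[OF s that] by (auto simp: up_def)
  have vals: "?p (up i j) < ?p (up i l)" "?p (up i l) < ?p (up i x)" "?p (up i x) < ?p (up i (j + 1))"
    using x by (simp_all add: p)
  have lN: "up i l \<le> m + 2" "1 \<le> up i x" using x by (auto simp: up_def)
  show ?thesis
  proof (cases "j + 1 = i")
    \<comment> \<open>The new maximum now stands directly after the old \<open>1\<close> and again
      takes over as the \<open>4\<close>.\<close>
    case True
    then have u: "up i j = j" "up i x = x" "up i l = l + 1" using x by (auto simp: up_def)
    have "?p (up i x) < ?p (j + 1)" using p[of x] v[of x] x True by simp
    then show ?thesis
      unfolding contains_3_14_2_def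
      using u x True vals by (intro exI[of _ x] exI[of _ j] exI[of _ "l + 1"]) auto
  next
    case False
    then have "up i (j + 1) = up i j + 1" using x by (auto simp: up_def)
    moreover have "up i (j + 1) < up i l" "up i x < up i j" using x by simp_all
    ultimately show ?thesis
      unfolding contains_3_14_2_def using vals lN by metis
  qed
qed

definition sites :: "nat \<Rightarrow> (nat \<Rightarrow> nat) \<Rightarrow> nat set" where
  "sites m \<sigma> = lr_max m \<sigma> \<union> Suc ` rl_max m \<sigma> \<union> {m + 1}"

lemma sites_bounds: "i \<in> sites m \<sigma> \<Longrightarrow> 1 \<le> i \<and> i \<le> m + 1"
  by (auto simp: sites_def lr_max_def rl_max_def)

text \<open>If \<open>i\<close> is not a left-to-right maximum, an earlier larger entry at
  \<open>x\<close> together with \<open>i\<close>, \<open>i + 1\<close> begins a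
  \<open>2-41\<close>, so everything after \<open>i\<close> must stay below the entry at
  \<open>x\<close>. A later entry above the one at \<open>z = i - 1\<close> would then complete a
  \<open>3-14-2\<close> with \<open>x\<close>, \<open>z\<close>, \<open>i\<close>. Hence
  \<open>z\<close> dominates all that follows, and comparison with the new last entry
  \<open>i\<close> puts it above the diagonal.\<close>

lemma site_if_baxter_insert:
  assumes s: "involution_on m \<sigma>" and i: "1 \<le> i" "i \<le> m + 1"
    and no: "\<not> contains_2_41_3 (m + 2) (insert_cycle m i \<sigma>)"
      "\<not> contains_3_14_2 (m + 2) (insert_cycle m i \<sigma>)"
  shows "i \<in> sites m \<sigma>"
proof (rule ccontr)
  assume "i \<notin> sites m \<sigma>"
  then have im: "i \<le> m" and nl: "i \<notin> lr_max m \<sigma>" and nr: "\<And>z. i = Suc z \<Longrightarrow> z \<notin> rl_max m \<sigma>"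
    using i by (auto simp: sites_def)
  let ?p = "insert_cycle m i \<sigma>"
  have p: "?p (up i y) = up i (\<sigma> y)" if "y \<le> m" for y
    using that i by (intro insert_cycle_up) auto
  have v: "up i (\<sigma> y) < m + 2" if "1 \<le> y" "y \<le> m" for y
    using involution_on_range[OF s that] by (auto simp: up_def)
  have low: "?p y = up i (\<sigma> y)" if "y < i" for y
    using p[of y] that im by (simp add: up_def)
  have high: "?p (y + 1) = up i (\<sigma> y)" if "i \<le> y" "y \<le> m" for y
    using p[of y] that by (simp add: up_def)
  have pN: "?p (m + 2) = i" "?p i = m + 2" using i by auto
  obtain x where x: "1 \<le> x" "x < i" "\<sigma> i < \<sigma> x"
    using nl im i involution_on_eq_iff[OF s] by (force simp: lr_max_def not_less le_less)
  have px: "?p (i + 1) < ?p x" "?p x < ?p i"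
    using x im low[of x] high[of i] v[of x] pN by auto
  have below: "?p l < ?p x" if l: "i < l" "l \<le> m + 2" for l
  proof (cases "l = i + 1")
    case False
    have "\<not> (?p x < ?p l \<and> ?p l < ?p i)"
      using no(1) x l False px unfolding contains_2_41_3_def
      by (metis Suc_eq_plus1 Suc_leI le_neq_implies_less)
    moreover have "?p l < ?p i"
    proof (cases "l = m + 2")
      case False
      then show ?thesis using l high[of "l - 1"] v[of "l - 1"] pN i by auto
    qed (use pN im in auto)
    moreover have "?p l \<noteq> ?p x"
      using involution_on_eq_iff[OF involution_on_insert[OF s i]] l x by auto
    ultimately show ?thesis by simp
  qed (use px in simp)
  obtain z where z: "i = Suc z" "1 \<le> z" using x i by (cases i) auto
  have top: "?p l < ?p z" if l: "i < l" "l \<le> m + 2" for l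
  proof (rule ccontr)
    assume "\<not> ?p l < ?p z"
    moreover have "?p l \<noteq> ?p z"
      using involution_on_eq_iff[OF involution_on_insert[OF s i]] l z by auto
    ultimately have a: "?p z < ?p l" by simp
    then have "x \<noteq> z" using below[OF l] by auto
    then have "x < z" using x z by simp
    then show False
      using no(2) a below[OF l] px x z l unfolding contains_3_14_2_def
      by (metis Suc_eq_plus1)
  qed
  have "z \<in> rl_max m \<sigma>"
    unfolding rl_max_def
  proof (intro CollectI conjI ballI)
    show "z \<in> {1..m}" using z im by simp
    have "i < up i (\<sigma> z)" using top[of "m + 2"] pN low[of z] z im by simp
    then show "z < \<sigma> z" using z by (auto simp: up_def split: if_splits)
    fix y assume y: "y \<in> {z<..m}"
    then show "\<sigma> y < \<sigma> z"
      using top[of "y + 1"] high[of y] low[of z] z by auto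
  qed
  with nr z show False by blast
qed

section \<open>Mirror images of the maxima, and pattern avoidance at the sites\<close>

text \<open>Reflection in the diagonal: no point lies to the upper left of
  \<open>(i, \<sigma> i)\<close>, hence none to the lower right of \<open>(\<sigma> i, i)\<close>.
  This mirror point is the old entry of value \<open>i\<close> that can stand in for the new last
  entry.\<close>

lemma lr_max_sentinel:
  assumes s: "involution_on m \<sigma>" and i: "i \<in> lr_max m \<sigma>"
  shows "i \<le> \<sigma> i" "\<And>z. \<sigma> i < z \<Longrightarrow> z \<le> m \<Longrightarrow> i < \<sigma> z"
proof -
  have im: "1 \<le> i" "i \<le> m" and mx: "\<And>y. 1 \<le> y \<Longrightarrow> y < i \<Longrightarrow> \<sigma> y < \<sigma> i"
    using i by (auto simp: lr_max_def)
  note inv = involution_on_involutive[OF s]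
  note rng = involution_on_range[OF s]
  show "i \<le> \<sigma> i"
    using mx[of "\<sigma> i"] rng[of i] im inv[of i] by fastforce
  fix z assume z: "\<sigma> i < z" "z \<le> m"
  show "i < \<sigma> z"
  proof (rule ccontr)
    assume "\<not> i < \<sigma> z"
    moreover have "\<sigma> z \<noteq> i" using z inv[of z] by auto
    ultimately have "z < \<sigma> i" using mx[of "\<sigma> z"] rng[of z] z inv[of z] by auto
    with z show False by simp
  qed
qed

text \<open>An empty upper right quadrant reflects to an empty upper right quadrant, so the mirror
  point of a right-to-left maximum is one too.\<close>

lemma rl_max_sentinel:
  assumes s: "involution_on m \<sigma>" and i: "i \<in> rl_max m \<sigma>"
    and z: "\<sigma> i < z" "z \<le> m"
  shows "\<sigma> z < i"
proof (rule ccontr)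
  note inv = involution_on_involutive[OF s]
  note rng = involution_on_range[OF s]
  assume "\<not> \<sigma> z < i"
  moreover have "\<sigma> z \<noteq> i" using z inv[of z] by auto
  ultimately have "i < \<sigma> z" "\<sigma> z \<le> m" using rng[of z] z by auto
  then have "\<sigma> (\<sigma> z) < \<sigma> i" using i by (auto simp: rl_max_def)
  then have "z < \<sigma> i" by (simp add: inv)
  with z show False by simp
qed

text \<open>
  The new last entry can only play the last letter of a forbidden pattern. In that role it can be
  replaced by the old entry of value \<open>i\<close> (resp. \<open>i - 1\<close>), which lies far enough to the right.
\<close>

lemma no_2_41_at_site:
  assumes s: "involution_on m \<sigma>" and no: "\<not> contains_2_41_3 m \<sigma>" and i: "i \<in> sites m \<sigma>"
    and x: "1 \<le> x" "x < j" "j + 1 \<le> m" "\<sigma> (j + 1) < \<sigma> x" "\<sigma> x < i" "i \<le> \<sigma> j"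
  shows False
proof -
  note inv = involution_on_involutive[OF s]
  note rng = involution_on_range[OF s]
  consider "i \<in> lr_max m \<sigma>" | z where "i = Suc z" "z \<in> rl_max m \<sigma>" | "i = m + 1"
    using i by (auto simp: sites_def)
  then show ?thesis
  proof cases
    case 1
    then have im: "1 \<le> i" "i \<le> m" by (auto simp: lr_max_def)
    have "j + 1 < \<sigma> i"
    proof (rule ccontr)
      assume "\<not> j + 1 < \<sigma> i"
      then consider "\<sigma> i = j + 1" | "\<sigma> i < j + 1" by linarith
      then show False
        using lr_max_sentinel(2)[OF s 1, of "j + 1"] x inv[of i] by cases auto
    qed
    moreover have "\<sigma> j \<noteq> i" using calculation inv by force
    ultimately show False
      using contains_2_41_3I[of x j "\<sigma> i" m \<sigma>] no x inv[of i] rng[of i] im by linarith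
  next
    case (2 z)
    then have zm: "1 \<le> z" "z < m" "z < \<sigma> z"
      using rng[of z] by (auto simp: rl_max_def)
    have "j + 1 < \<sigma> z"
    proof (rule ccontr)
      assume "\<not> j + 1 < \<sigma> z"
      then consider "\<sigma> z = j + 1" | "\<sigma> z = j" | "\<sigma> z < j" by linarith
      then show False
        using rl_max_sentinel[OF s 2(2), of j] x inv[of z] 2(1) by cases auto
    qed
    moreover have "\<sigma> x \<noteq> z" using calculation inv[of x] x by force
    ultimately show False
      using contains_2_41_3I[of x j "\<sigma> z" m \<sigma>] no x inv[of z] rng[of z] zm 2(1) by linarith
  next
    case 3
    then show False using rng[of j] x by simp
  qed
qed

lemma no_3_14_at_site:
  assumes s: "involution_on m \<sigma>" and no: "\<not> contains_3_14_2 m \<sigma>" and i: "i \<in> sites m \<sigma>"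
    and x: "1 \<le> x" "x < j" "j + 1 \<le> m" "\<sigma> j < i" "i \<le> \<sigma> x" "\<sigma> x < \<sigma> (j + 1)"
  shows False
proof -
  note inv = involution_on_involutive[OF s]
  note rng = involution_on_range[OF s]
  consider "i \<in> lr_max m \<sigma>" | z where "i = Suc z" "z \<in> rl_max m \<sigma>" | "i = m + 1"
    using i by (auto simp: sites_def)
  then show ?thesis
  proof cases
    case 1
    then have im: "1 \<le> i" "i \<le> m" by (auto simp: lr_max_def)
    have "j + 1 < \<sigma> i"
    proof (rule ccontr)
      assume "\<not> j + 1 < \<sigma> i"
      then consider "\<sigma> i = j + 1" | "\<sigma> i = j" | "\<sigma> i < j" by linarith
      then show False
        using lr_max_sentinel(2)[OF s 1, of j] x inv[of i] by cases auto
    qed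
    moreover have "\<sigma> x \<noteq> i" using calculation inv[of x] x by force
    ultimately show False
      using contains_3_14_2I[of x j "\<sigma> i" m \<sigma>] no x inv[of i] rng[of i] im by linarith
  next
    case (2 z)
    then have zm: "1 \<le> z" "z < m" "z < \<sigma> z"
      using rng[of z] by (auto simp: rl_max_def)
    have "j + 1 < \<sigma> z"
    proof (rule ccontr)
      assume "\<not> j + 1 < \<sigma> z"
      then consider "\<sigma> z = j + 1" | "\<sigma> z < j + 1" by linarith
      then show False
        using rl_max_sentinel[OF s 2(2), of "j + 1"] x inv[of z] 2(1) by cases auto
    qed
    moreover have "\<sigma> j \<noteq> z" using calculation inv[of j] x by force
    ultimately show False
      using contains_3_14_2I[of x j "\<sigma> z" m \<sigma>] no x inv[of z] rng[of z] zm 2(1) by linarith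
  next
    case 3
    then show False using rng[of x] x by simp
  qed
qed

text \<open>An occurrence is read back in \<open>\<sigma>\<close>; apart from the new last entry,
  only a \<open>4\<close> at \<open>j = i\<close> has no preimage. At a left-to-right maximum the
  \<open>2\<close> would be smaller than the \<open>1\<close>; after a right-to-left maximum the
  entry at \<open>i - 1\<close> replaces the \<open>4\<close>; at the end there is no room for the
  \<open>3\<close>.\<close>

lemma not_contains_2_41_3_insert:
  assumes s: "involution_on m \<sigma>" and no: "\<not> contains_2_41_3 m \<sigma>" and i: "i \<in> sites m \<sigma>"
  shows "\<not> contains_2_41_3 (m + 2) (insert_cycle m i \<sigma>)"
proof
  let ?p = "insert_cycle m i \<sigma>"
  have ib: "1 \<le> i" "i \<le> m + 1" using sites_bounds[OF i] by auto
  assume "contains_2_41_3 (m + 2) ?p"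
  then obtain x j l where x: "1 \<le> x" "x < j" "j + 1 < l" "l \<le> m + 2"
      "?p (j + 1) < ?p x" "?p x < ?p l" "?p l < ?p j"
    unfolding contains_2_41_3_def by blast
  have p: "?p (up i y) = up i (\<sigma> y)" if "y \<le> m" for y
    using that ib by (intro insert_cycle_up) auto
  have bd: "?p y \<le> m + 2" if "1 \<le> y" "y \<le> m + 2" for y
    using involution_on_range(2)[OF involution_on_insert[OF s ib] that] .
  have pN: "?p (m + 2) = i" "?p i = m + 2" using ib by auto
  have ne: "x \<noteq> i" "j + 1 \<noteq> i" "l \<noteq> i"
    using x bd[of x] bd[of j] bd[of l] pN by auto
  define x' where "x' = down i x"
  have x': "x = up i x'" "x' \<le> m" "1 \<le> x'" using x ne ib by (auto simp: x'_def up_def down_def)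
  have px: "?p x = up i (\<sigma> x')" using p x' by simp
  \<comment> \<open>The occurrence is anchored at its \<open>1\<close>, so that \<open>k - 1\<close>
    is the place for the \<open>4\<close> even if \<open>j = i\<close> is the new maximum.\<close>
  define k where "k = down i (j + 1)"
  have k: "j + 1 = up i k" "k \<le> m" "1 \<le> k" using x ne ib by (auto simp: k_def up_def down_def)
  have pk: "?p (j + 1) = up i (\<sigma> k)" using p k by simp
  have k2: "x' < k - 1" if "x \<noteq> i - 1 \<or> j \<noteq> i"
    using that x ne ib by (auto simp: x'_def k_def down_def)
  have main: False if h: "?p l < up i (\<sigma> (k - 1))" "x' < k - 1"
  proof (cases "l = m + 2")
    case True
    then have "i \<le> \<sigma> (k - 1)" using h pN by (auto simp: up_def split: if_splits)
    moreover have "\<sigma> x' < i" using True x px pN by (auto simp: up_def split: if_splits)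
    moreover have "\<sigma> k < \<sigma> x'" using x px pk by simp
    ultimately show False
      using no_2_41_at_site[OF s no i, of x' "k - 1"] h x' k by simp
  next
    case False
    define l' where "l' = down i l"
    have l': "l = up i l'" "l' \<le> m" using x ne False ib by (auto simp: l'_def up_def down_def)
    have "k < l'" using x(3) k(1) l'(1) by simp
    moreover have "\<sigma> k < \<sigma> x'" "\<sigma> x' < \<sigma> l'" "\<sigma> l' < \<sigma> (k - 1)"
      using x px pk p[OF l'(2)] l'(1) h by auto
    ultimately show False
      using contains_2_41_3I[of x' "k - 1" l' m \<sigma>] no h x' l' k by simp
  qed
  show False
  proof (cases "j = i")
    case False
    then have "j = up i (k - 1)" using x ne ib by (auto simp: k_def up_def down_def)
    with main k2 p[of "k - 1"] x k False show False by simp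
  next
    case True
    then have k_i: "k = i" "x' = x" using x by (auto simp: k_def x'_def down_def)
    consider "i \<in> lr_max m \<sigma>" | z where "i = Suc z" "z \<in> rl_max m \<sigma>" | "i = m + 1"
      using i by (auto simp: sites_def)
    then show False
    proof cases
      case 1
      then have "\<sigma> x < \<sigma> i" using x True by (auto simp: lr_max_def)
      then show False using x px pk k_i by simp
    next
      case (2 z)
      then have zi: "z < \<sigma> z" and mx: "\<And>y. z < y \<Longrightarrow> y \<le> m \<Longrightarrow> \<sigma> y < \<sigma> z"
        by (auto simp: rl_max_def)
      have top: "?p l < up i (\<sigma> z)"
      proof (cases "l = m + 2")
        case True
        then show ?thesis using pN zi 2(1) by (simp add: up_def)
      next
        case False
        define l' where "l' = down i l"
        have l': "l = up i l'" "l' \<le> m" "z < l'"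
          using x ne False ib True 2 by (auto simp: l'_def up_def down_def)
        then show ?thesis using p[OF l'(2)] mx[of l'] by simp
      qed
      have "x \<noteq> z" using top x px k_i by auto
      then show False using main top k_i 2(1) x True by simp
    next
      case 3
      then show False using x True by simp
    qed
  qed
qed

text \<open>Now the lost \<open>4\<close> is at \<open>j + 1 = i\<close>. At a left-to-right maximum
  the old entry at \<open>i\<close> replaces it; after a right-to-left maximum the \<open>1\<close>
  would exceed the \<open>2\<close>; at the end the \<open>2\<close> would be \<open>m + 1\<close>,
  too large to leave a value for the \<open>3\<close>.\<close>

lemma not_contains_3_14_2_insert:
  assumes s: "involution_on m \<sigma>" and no: "\<not> contains_3_14_2 m \<sigma>" and i: "i \<in> sites m \<sigma>"
  shows "\<not> contains_3_14_2 (m + 2) (insert_cycle m i \<sigma>)"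
proof
  let ?p = "insert_cycle m i \<sigma>"
  note rng = involution_on_range[OF s]
  have ib: "1 \<le> i" "i \<le> m + 1" using sites_bounds[OF i] by auto
  assume "contains_3_14_2 (m + 2) ?p"
  then obtain x j l where x: "1 \<le> x" "x < j" "j + 1 < l" "l \<le> m + 2"
      "?p j < ?p l" "?p l < ?p x" "?p x < ?p (j + 1)"
    unfolding contains_3_14_2_def by blast
  have p: "?p (up i y) = up i (\<sigma> y)" if "y \<le> m" for y
    using that ib by (intro insert_cycle_up) auto
  have bd: "?p y \<le> m + 2" if "1 \<le> y" "y \<le> m + 2" for y
    using involution_on_range(2)[OF involution_on_insert[OF s ib] that] .
  have pN: "?p (m + 2) = i" "?p i = m + 2" using ib by auto
  have ne: "x \<noteq> i" "j \<noteq> i" "l \<noteq> i"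
    using x bd[of x] bd[of "j + 1"] bd[of l] pN by auto
  define x' where "x' = down i x"
  have x': "x = up i x'" "x' \<le> m" "1 \<le> x'" using x ne ib by (auto simp: x'_def up_def down_def)
  have px: "?p x = up i (\<sigma> x')" using p x' by simp
  define k where "k = down i j"
  have k: "j = up i k" "k \<le> m" "1 \<le> k" using x ne ib by (auto simp: k_def up_def down_def)
  have pk: "?p j = up i (\<sigma> k)" using p k by simp
  have xk: "x' < k" using x(2) x' k by simp
  have main: False if h: "\<sigma> x' < \<sigma> (k + 1)" "k + 1 \<le> m"
  proof (cases "l = m + 2")
    case True
    then have "i \<le> \<sigma> x'" using x px pN by (auto simp: up_def split: if_splits)
    moreover have "\<sigma> k < i" using True x pk pN by (auto simp: up_def split: if_splits)
    ultimately show False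
      using no_3_14_at_site[OF s no i, of x' k] h x' xk by simp
  next
    case False
    define l' where "l' = down i l"
    have l': "l = up i l'" "l' \<le> m" using x ne False ib by (auto simp: l'_def up_def down_def)
    have vals: "\<sigma> k < \<sigma> l'" "\<sigma> l' < \<sigma> x'"
      using x px pk p[OF l'(2)] l'(1) h by auto
    have "up i k < up i l'" using x(3) k(1) l'(1) by linarith
    then have "k < l'" by simp
    moreover have "l' \<noteq> k + 1" using vals h by auto
    ultimately show False
      using contains_3_14_2I[of x' k l' m \<sigma>] no h x' l' xk vals by simp
  qed
  show False
  proof (cases "j + 1 = i")
    case False
    then have j1: "j + 1 = up i (k + 1)" "k + 1 \<le> m" using x ne ib by (auto simp: k_def up_def down_def)
    with main p[of "k + 1"] x(7) px show False by simp
  next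
    case True
    then have k_i: "k = j" "x' = x" using x by (auto simp: k_def x'_def down_def)
    consider "i \<in> lr_max m \<sigma>" | z where "i = Suc z" "z \<in> rl_max m \<sigma>" | "i = m + 1"
      using i by (auto simp: sites_def)
    then show False
    proof cases
      case 1
      then show False using main k_i x True by (auto simp: lr_max_def)
    next
      case (2 z)
      then have z: "z = j" "z < \<sigma> z" and mx: "\<And>y. z < y \<Longrightarrow> y \<le> m \<Longrightarrow> \<sigma> y < \<sigma> z"
        using True by (auto simp: rl_max_def)
      have "?p l < up i (\<sigma> z)"
      proof (cases "l = m + 2")
        case True
        then show ?thesis using pN z 2(1) by (simp add: up_def)
      next
        case False
        define l' where "l' = down i l"
        have l': "l = up i l'" "l' \<le> m" "z < l'"
          using x ne False ib True 2 by (auto simp: l'_def up_def down_def)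
        then show ?thesis using p[OF l'(2)] mx[of l'] by simp
      qed
      then show False using x pk k_i z by simp
    next
      case 3
      then have "l = m + 2" using x True by simp
      then have "m + 1 < up i (\<sigma> x')" using x px pN 3 by simp
      then show False using rng[of x'] x' 3 by (auto simp: up_def)
    qed
  qed
qed

lemma involutive_baxter_insert_iff:
  assumes "involution_on m \<sigma>" "1 \<le> i" "i \<le> m + 1"
  shows "involutive_baxter (m + 2) (insert_cycle m i \<sigma>) \<longleftrightarrow>
    involutive_baxter m \<sigma> \<and> i \<in> sites m \<sigma>"
  using assms involution_on_insert[OF assms] site_if_baxter_insert[OF assms]
    contains_2_41_3_insert[OF assms] contains_3_14_2_insert[OF assms]
    not_contains_2_41_3_insert[of m \<sigma> i] not_contains_3_14_2_insert[of m \<sigma> i]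
  unfolding involutive_baxter_iff by blast

section \<open>Statistics under insertion\<close>

text \<open>Insertion at a maximum leaves the rank of that maximum as a label, so a sum over sites
  turns into a sum over ranks.\<close>

lemma sum_card_le_eq:
  fixes A :: "'a::linorder set" and f :: "nat \<Rightarrow> 'b::comm_monoid_add"
  assumes "finite A"
  shows "(\<Sum>i\<in>A. f (card {x\<in>A. x \<le> i})) = (\<Sum>j=1..card A. f j)"
  using assms
proof (induction A rule: finite_linorder_max_induct)
  case (insert b A)
  have b: "b \<notin> A" using insert by auto
  have "{x \<in> insert b A. x \<le> i} = {x \<in> A. x \<le> i}" if "i \<in> A" for i
    using insert(2) that by auto
  moreover have "{x \<in> insert b A. x \<le> b} = insert b A"
    using insert(2) by auto
  ultimately show ?case using insert b by (simp add: add.commute)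
qed simp

lemma sum_card_ge_eq:
  fixes A :: "'a::linorder set" and f :: "nat \<Rightarrow> 'b::comm_monoid_add"
  assumes "finite A"
  shows "(\<Sum>i\<in>A. f (card {x\<in>A. i \<le> x})) = (\<Sum>j=1..card A. f j)"
  using assms
proof (induction A rule: finite_linorder_min_induct)
  case (insert b A)
  have b: "b \<notin> A" using insert by auto
  have "{x \<in> insert b A. i \<le> x} = {x \<in> A. i \<le> x}" if "i \<in> A" for i
    using insert(2) that by auto
  moreover have "{x \<in> insert b A. b \<le> x} = insert b A"
    using insert(2) by auto
  ultimately show ?case using insert b by (simp add: add.commute)
qed simp

lemma finite_lr_max [simp]: "finite (lr_max N \<pi>)"
  by (simp add: lr_max_def)

lemma finite_rl_max [simp]: "finite (rl_max N \<pi>)"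
  by (simp add: rl_max_def)

lemma sum_sites:
  "(\<Sum>i\<in>sites m \<sigma>. f i) =
     (\<Sum>i\<in>lr_max m \<sigma>. f i) + (\<Sum>z\<in>rl_max m \<sigma>. f (Suc z)) + (f (m + 1) :: 'b::comm_monoid_add)"
  if s: "involution_on m \<sigma>"
proof -
  have z: "Suc z \<le> m" if "z \<in> rl_max m \<sigma>" for z
    using that involution_on_range[OF s, of z] by (auto simp: rl_max_def)
  have "Suc z \<notin> lr_max m \<sigma>" if "z \<in> rl_max m \<sigma>" for z
  proof -
    have "\<sigma> (Suc z) < \<sigma> z" using that z[OF that] by (simp add: rl_max_def)
    moreover have "1 \<le> z" using that by (simp add: rl_max_def)
    ultimately show ?thesis by (auto simp: lr_max_def intro!: bexI[of _ z])
  qed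
  then have "lr_max m \<sigma> \<inter> Suc ` rl_max m \<sigma> = {}" by auto
  moreover have "m + 1 \<notin> lr_max m \<sigma> \<union> Suc ` rl_max m \<sigma>"
    using z by (force simp: lr_max_def)
  ultimately show ?thesis
    unfolding sites_def by (simp add: sum.union_disjoint sum.reindex add.commute)
qed

context
  fixes m i \<sigma>
  assumes s: "involution_on m \<sigma>" and i: "1 \<le> i" "i \<le> m + 1"
begin

lemma insert_low: "1 \<le> y \<Longrightarrow> y < i \<Longrightarrow> insert_cycle m i \<sigma> y = up i (\<sigma> y)"
  using insert_cycle_up[of i m y \<sigma>] i by (auto simp: up_def)

lemma insert_high: "i \<le> y \<Longrightarrow> y \<le> m \<Longrightarrow> insert_cycle m i \<sigma> (Suc y) = up i (\<sigma> y)"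
  using insert_cycle_up[of i m y \<sigma>] i by (auto simp: up_def)

lemma up_less_top: "1 \<le> y \<Longrightarrow> y \<le> m \<Longrightarrow> up i (\<sigma> y) < Suc (Suc m)"
  using involution_on_range[OF s, of y] by (auto simp: up_def)

lemma insert_less_top: "1 \<le> y \<Longrightarrow> y \<le> m + 2 \<Longrightarrow> y \<noteq> i \<Longrightarrow> insert_cycle m i \<sigma> y < m + 2"
  by (rule insert_cycle_cases[OF i, of y \<sigma>]) (use i up_less_top in auto)

lemma lr_max_insert: "lr_max (m + 2) (insert_cycle m i \<sigma>) = {x \<in> lr_max m \<sigma>. x < i} \<union> {i}"
proof (intro set_eqI iffI)
  fix x assume x: "x \<in> lr_max (m + 2) (insert_cycle m i \<sigma>)"
  then have xm: "1 \<le> x" "x \<le> m + 2" by (auto simp: lr_max_def)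
  show "x \<in> {x \<in> lr_max m \<sigma>. x < i} \<union> {i}"
  proof (cases "x < i")
    case True
    have "\<sigma> y < \<sigma> x" if "1 \<le> y" "y < x" for y
    proof -
      have "insert_cycle m i \<sigma> y < insert_cycle m i \<sigma> x" using x that by (auto simp: lr_max_def)
      then show ?thesis using that True by (simp add: insert_low)
    qed
    with True xm i show ?thesis by (auto simp: lr_max_def)
  next
    case False
    have "\<not> i < x"
    proof
      assume ix: "i < x"
      then have "insert_cycle m i \<sigma> i < insert_cycle m i \<sigma> x"
        using x i by (auto simp: lr_max_def simp del: insert_cycle_simps)
      then show False using insert_less_top[of x] xm ix by simp
    qed
    with False show ?thesis by simp
  qed
next
  fix x assume "x \<in> {x \<in> lr_max m \<sigma>. x < i} \<union> {i}"
  then show "x \<in> lr_max (m + 2) (insert_cycle m i \<sigma>)"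
    using i by (auto simp: lr_max_def insert_low[unfolded One_nat_def] up_less_top[unfolded One_nat_def])
qed

lemma rl_max_insert: "rl_max (m + 2) (insert_cycle m i \<sigma>) = {i} \<union> Suc ` {x \<in> rl_max m \<sigma>. i \<le> x}"
proof (intro set_eqI iffI)
  fix x assume x: "x \<in> rl_max (m + 2) (insert_cycle m i \<sigma>)"
  then have xm: "1 \<le> x" "x \<le> m + 2" "x < insert_cycle m i \<sigma> x"
    and mx: "\<And>y. x < y \<Longrightarrow> y \<le> m + 2 \<Longrightarrow> insert_cycle m i \<sigma> y < insert_cycle m i \<sigma> x"
    by (auto simp: rl_max_def)
  have "\<not> x < i"
  proof
    assume "x < i"
    then have "insert_cycle m i \<sigma> i < insert_cycle m i \<sigma> x" using mx[of i] i by simp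
    then show False using insert_less_top[of x] xm \<open>x < i\<close> by simp
  qed
  moreover have "x \<noteq> m + 2" using xm i by auto
  moreover have "x \<in> Suc ` {x \<in> rl_max m \<sigma>. i \<le> x}" if h: "i < x" "x < m + 2"
  proof -
    obtain z where z: "x = Suc z" "i \<le> z" "z \<le> m" using h by (cases x) auto
    have "\<sigma> y < \<sigma> z" if "z < y" "y \<le> m" for y
      using mx[of "Suc y"] that z by (simp add: insert_high)
    moreover have "z < \<sigma> z" using xm(3) z by (simp add: insert_high up_def split: if_splits)
    ultimately show ?thesis using z i by (auto simp: rl_max_def)
  qed
  ultimately show "x \<in> {i} \<union> Suc ` {x \<in> rl_max m \<sigma>. i \<le> x}" using xm by (cases "x = i") auto
next
  fix x assume "x \<in> {i} \<union> Suc ` {x \<in> rl_max m \<sigma>. i \<le> x}"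
  then consider "x = i" | z where "x = Suc z" "z \<in> rl_max m \<sigma>" "i \<le> z" by auto
  then show "x \<in> rl_max (m + 2) (insert_cycle m i \<sigma>)"
  proof cases
    case 1
    then show ?thesis using i insert_less_top by (auto simp: rl_max_def)
  next
    case (2 z)
    then have z: "z \<le> m" "z < \<sigma> z" and mx: "\<And>y. z < y \<Longrightarrow> y \<le> m \<Longrightarrow> \<sigma> y < \<sigma> z"
      by (auto simp: rl_max_def)
    have pz: "insert_cycle m i \<sigma> x = Suc (\<sigma> z)" using 2 z by (simp add: insert_high up_def)
    have "insert_cycle m i \<sigma> y < insert_cycle m i \<sigma> x" if h: "x < y" "y \<le> m + 2" for y
    proof (cases "y = m + 2")
      case True
      then show ?thesis using pz 2 z i by simp
    next
      case False
      then obtain y' where "y = Suc y'" "i \<le> y'" "y' \<le> m" using h 2 by (cases y) auto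
      then show ?thesis using mx[of y'] h 2 z by (simp add: insert_high)
    qed
    then show ?thesis using pz z 2 i by (auto simp: rl_max_def)
  qed
qed

lemma card_fixed_points_insert:
  "card (fixed_points (m + 2) (insert_cycle m i \<sigma>)) = card (fixed_points m \<sigma>)"
proof -
  have "fixed_points (m + 2) (insert_cycle m i \<sigma>) = up i ` fixed_points m \<sigma>"
  proof (intro set_eqI iffI)
    fix x assume "x \<in> fixed_points (m + 2) (insert_cycle m i \<sigma>)"
    then have x: "1 \<le> x" "x \<le> m + 2" "insert_cycle m i \<sigma> x = x" by (auto simp: fixed_points_def)
    then show "x \<in> up i ` fixed_points m \<sigma>"
      by (cases rule: insert_cycle_cases[OF i x(1,2), of \<sigma>]) (use i in \<open>auto simp: fixed_points_def\<close>)
  next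
    fix x assume "x \<in> up i ` fixed_points m \<sigma>"
    then obtain y where "x = up i y" "1 \<le> y" "y \<le> m" "\<sigma> y = y" by (auto simp: fixed_points_def)
    then show "x \<in> fixed_points (m + 2) (insert_cycle m i \<sigma>)"
      using insert_cycle_up[of i m y \<sigma>] i by (auto simp: fixed_points_def up_def)
  qed
  moreover have "inj_on (up i) (fixed_points m \<sigma>)" by (simp add: inj_on_def)
  ultimately show ?thesis by (simp add: card_image)
qed

end

section \<open>Descents created and destroyed by an insertion\<close>

text \<open>\<open>P x\<close> and \<open>Q x\<close> are read as properties of the adjacency of
  \<open>x\<close> and \<open>x + 1\<close>. The two new columns break the adjacency at
  \<open>i - 1\<close> and create those at \<open>i - 1\<close>, \<open>i\<close> and
  \<open>m + 1\<close>. For \<open>i = m + 1\<close> nothing is broken and the last two coincide,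
  whence the guards. The broken one is added on the left to avoid truncated subtraction.\<close>

lemma card_adjacent_insert:
  fixes P Q :: "nat \<Rightarrow> bool"
  assumes i: "1 \<le> i" "i \<le> m + 1"
    and low: "\<And>x. 1 \<le> x \<Longrightarrow> x + 1 < i \<Longrightarrow> Q x = P x"
    and high: "\<And>x. i \<le> x \<Longrightarrow> x < m \<Longrightarrow> Q (Suc x) = P x"
  shows "card {x\<in>{1..<m + 2}. Q x} + of_bool (2 \<le> i \<and> i \<le> m \<and> P (i - 1)) =
    card {x\<in>{1..<m}. P x} + of_bool (2 \<le> i \<and> Q (i - 1)) + of_bool (i \<le> m \<and> Q i) + of_bool (Q (m + 1))"
proof -
  have card_sum: "card {x\<in>{a..<b}. R x} = (\<Sum>x\<in>{a..<b}. of_bool (R x))" for a b :: nat and R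
    by (simp add: sum_of_bool_eq Int_def)
  obtain z where z: "i = Suc z" "z \<le> m" using i by (cases i) auto
  have l: "(\<Sum>x\<in>{1..<z}. of_bool (Q x)) = (\<Sum>x\<in>{1..<z}. of_bool (P x) :: nat)"
    using low z by (intro sum.cong) auto
  have "(\<Sum>x\<in>{Suc i..<Suc m}. of_bool (Q x)) = (\<Sum>x\<in>{i..<m}. of_bool (Q (Suc x)) :: nat)"
    by (rule sum.shift_bounds_Suc_ivl)
  also have "\<dots> = (\<Sum>x\<in>{i..<m}. of_bool (P x))"
    using high by (intro sum.cong) auto
  finally have h: "(\<Sum>x\<in>{Suc i..<Suc m}. of_bool (Q x)) = (\<Sum>x\<in>{i..<m}. of_bool (P x) :: nat)" .
  have q: "(\<Sum>x\<in>{1..<m + 2}. of_bool (Q x) :: nat) = (\<Sum>x\<in>{1..<i}. of_bool (Q x)) +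
      (if i \<le> m then of_bool (Q i) + (\<Sum>x\<in>{Suc i..<Suc m}. of_bool (Q x)) else 0) + of_bool (Q (m + 1))"
  proof -
    have "(\<Sum>x\<in>{1..<m + 2}. of_bool (Q x) :: nat) =
        (\<Sum>x\<in>{1..<i}. of_bool (Q x)) + (\<Sum>x\<in>{i..<Suc m}. of_bool (Q x)) + of_bool (Q (m + 1))"
      using i sum.atLeastLessThan_concat[of 1 i "Suc m" "\<lambda>x. of_bool (Q x) :: nat"]
      by (simp del: sum_of_bool_eq sum.op_ivl_Suc) (simp del: sum_of_bool_eq)
    moreover have "i = Suc m \<or> i \<le> m" using i by linarith
    ultimately show ?thesis
      by (elim disjE) (auto simp: sum.atLeast_Suc_lessThan simp del: sum_of_bool_eq sum.op_ivl_Suc)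
  qed
  have lo: "(\<Sum>x\<in>{1..<i}. of_bool (R x) :: nat) = (\<Sum>x\<in>{1..<z}. of_bool (R x)) + of_bool (2 \<le> i \<and> R (i - 1))"
    for R using z by (cases z) (auto simp del: sum_of_bool_eq)
  have p: "(\<Sum>x\<in>{1..<m}. of_bool (P x) :: nat) =
      (\<Sum>x\<in>{1..<z}. of_bool (P x)) + of_bool (2 \<le> i \<and> i \<le> m \<and> P (i - 1)) + (\<Sum>x\<in>{i..<m}. of_bool (P x))"
  proof (cases "i \<le> m")
    case True
    then have "(\<Sum>x\<in>{1..<m}. of_bool (P x) :: nat) = (\<Sum>x\<in>{1..<i}. of_bool (P x)) + (\<Sum>x\<in>{i..<m}. of_bool (P x))"
      using i by (simp add: sum.atLeastLessThan_concat del: sum_of_bool_eq)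
    with True show ?thesis using lo[of P] by (simp del: sum_of_bool_eq)
  next
    case False
    then have "z = m" using z by simp
    with False z show ?thesis by (simp del: sum_of_bool_eq)
  qed
  show ?thesis
    unfolding card_sum using l h q p lo[of Q] i by (auto simp del: sum_of_bool_eq)
qed

text \<open>The flag \<open>c\<close> lets one computation serve both kinds of descents.\<close>

definition adjacent_descent :: "bool \<Rightarrow> (nat \<Rightarrow> nat) \<Rightarrow> nat \<Rightarrow> bool" where
  "adjacent_descent c \<pi> x \<longleftrightarrow> \<pi> (Suc x) < \<pi> x \<and> (crosses_diagonal \<pi> x \<longleftrightarrow> c)"

lemma crossing_descents_eq: "crossing_descents N \<pi> = {x\<in>{1..<N}. adjacent_descent True \<pi> x}"
  by (auto simp: crossing_descents_def descents_def adjacent_descent_def)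

lemma noncrossing_descents_eq: "noncrossing_descents N \<pi> = {x\<in>{1..<N}. adjacent_descent False \<pi> x}"
  by (auto simp: noncrossing_descents_def descents_def adjacent_descent_def)

text \<open>The new maximum is preceded by an ascent and followed by a descent, which crosses
  exactly when the old entry \<open>\<sigma> i\<close> is below the diagonal. For
  \<open>i \<le> m\<close> the entry at \<open>m + 1\<close> is at most \<open>m + 1\<close>, so a
  descent into the last entry cannot cross; for \<open>i = m + 1\<close> the new cycle is itself a
  crossing descent.\<close>

lemma card_adjacent_descent_insert:
  assumes s: "involution_on m \<sigma>" and i: "1 \<le> i" "i \<le> m + 1"
  shows "card {x\<in>{1..<m + 2}. adjacent_descent c (insert_cycle m i \<sigma>) x}
      + of_bool (2 \<le> i \<and> i \<le> m \<and> adjacent_descent c \<sigma> (i - 1)) =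
    card {x\<in>{1..<m}. adjacent_descent c \<sigma> x}
      + of_bool (i \<le> m \<and> (\<sigma> i < i \<longleftrightarrow> c))
      + of_bool (if i \<le> m then i \<le> \<sigma> m \<and> \<not> c else c)"
proof -
  let ?p = "insert_cycle m i \<sigma>"
  note low = insert_low[OF s i] and high = insert_high[OF s i]
  have up_gt: "up i y > x \<longleftrightarrow> y > x" if "x < i" for x y using that by (auto simp: up_def)
  have up_lt: "up i y < x \<longleftrightarrow> y < x" if "x \<le> i" for x y using that by (auto simp: up_def)
  have up_gt': "up i y > Suc x \<longleftrightarrow> y > x" if "i \<le> x" for x y using that by (auto simp: up_def)
  have up_lt': "up i y < Suc x \<longleftrightarrow> y < x" if "i \<le> x" for x y using that by (auto simp: up_def)
  have 1: "adjacent_descent c ?p x = adjacent_descent c \<sigma> x" if "1 \<le> x" "x + 1 < i" for x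
    using that by (simp add: adjacent_descent_def crosses_diagonal_def low up_gt up_lt)
  have 2: "adjacent_descent c ?p (Suc x) = adjacent_descent c \<sigma> x" if "i \<le> x" "x < m" for x
    using that high[of x] high[of "Suc x"] up_gt'[of x] up_lt'[of "Suc x"]
    by (simp add: adjacent_descent_def crosses_diagonal_def)
  have 3: "\<not> (2 \<le> i \<and> adjacent_descent c ?p (i - 1))"
    using insert_less_top[OF s i, of "i - 1"] i
    by (cases i) (auto simp: adjacent_descent_def)
  have 4: "adjacent_descent c ?p i \<longleftrightarrow> (\<sigma> i < i \<longleftrightarrow> c)" if "i \<le> m"
    using that i high[of i] up_less_top[OF s i, of i] up_lt'[of i]
    by (simp add: adjacent_descent_def crosses_diagonal_def)
  have 5: "adjacent_descent c ?p (m + 1) \<longleftrightarrow> (if i \<le> m then i \<le> \<sigma> m \<and> \<not> c else c)"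
  proof (cases "i \<le> m")
    case True
    then show ?thesis
      using i high[of m] up_less_top[OF s i, of m]
      by (auto simp: adjacent_descent_def crosses_diagonal_def) (auto simp: up_def split: if_splits)
  next
    case False
    then have "i = m + 1" using i by simp
    then show ?thesis using insert_cycle_simps[of m i \<sigma>]
      by (auto simp: adjacent_descent_def crosses_diagonal_def)
  qed
  have 6: "of_bool (i \<le> m \<and> adjacent_descent c ?p i) = (of_bool (i \<le> m \<and> (\<sigma> i < i \<longleftrightarrow> c)) :: nat)"
    using 4 by auto
  show ?thesis
    using card_adjacent_insert[OF i, where P = "adjacent_descent c \<sigma>" and Q = "adjacent_descent c ?p", OF 1 2]
    unfolding 5 6 using 3 by simp
qed

text \<open>No descent is broken, since \<open>i - 1\<close> was an ascent. The new descents follow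
  the new maximum, where the next entry is on or above the diagonal, and precede the last entry.
  Every right-to-left maximum above the diagonal lies at or after \<open>i\<close>, so the new entry
  hides none.\<close>

lemma insert_lr_max_stats:
  assumes s: "involution_on m \<sigma>" and i: "i \<in> lr_max m \<sigma>"
  shows "card (noncrossing_descents (m + 2) (insert_cycle m i \<sigma>)) = card (noncrossing_descents m \<sigma>) + 2"
    and "card (crossing_descents (m + 2) (insert_cycle m i \<sigma>)) = card (crossing_descents m \<sigma>)"
    and "card (lr_max (m + 2) (insert_cycle m i \<sigma>)) = card {x \<in> lr_max m \<sigma>. x \<le> i}"
    and "card (rl_max (m + 2) (insert_cycle m i \<sigma>)) = card (rl_max m \<sigma>) + 1"
proof -
  have im: "1 \<le> i" "i \<le> m + 1" "i \<le> m" and mx: "\<And>y. 1 \<le> y \<Longrightarrow> y < i \<Longrightarrow> \<sigma> y < \<sigma> i"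
    using i by (auto simp: lr_max_def)
  note sen = lr_max_sentinel[OF s i]
  have last: "i \<le> \<sigma> m"
    using sen(2)[of m] involution_on_range[OF s im(1,3)] involution_on_involutive[OF s, of i]
    by (cases "\<sigma> i = m") auto
  have np: "\<not> (2 \<le> i \<and> i \<le> m \<and> adjacent_descent c \<sigma> (i - 1))" for c
    using mx[of "i - 1"] by (cases i) (auto simp: adjacent_descent_def)
  have *: "card {x\<in>{1..<m + 2}. adjacent_descent c (insert_cycle m i \<sigma>) x} =
      card {x\<in>{1..<m}. adjacent_descent c \<sigma> x} + (if c then 0 else 2)" for c
    using card_adjacent_descent_insert[OF s im(1,2), of c] np[of c] sen(1) last im by auto
  show "card (noncrossing_descents (m + 2) (insert_cycle m i \<sigma>)) = card (noncrossing_descents m \<sigma>) + 2"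
    "card (crossing_descents (m + 2) (insert_cycle m i \<sigma>)) = card (crossing_descents m \<sigma>)"
    unfolding crossing_descents_eq noncrossing_descents_eq * by simp_all
  have "lr_max (m + 2) (insert_cycle m i \<sigma>) = {x \<in> lr_max m \<sigma>. x \<le> i}"
    unfolding lr_max_insert[OF s im(1,2)] using i by auto
  then show "card (lr_max (m + 2) (insert_cycle m i \<sigma>)) = card {x \<in> lr_max m \<sigma>. x \<le> i}" by simp
  have "i \<le> x" if "x \<in> rl_max m \<sigma>" for x
  proof (rule ccontr)
    assume "\<not> i \<le> x"
    then have "\<sigma> i < \<sigma> x" "\<sigma> x < \<sigma> i" using that mx[of x] im by (auto simp: rl_max_def)
    then show False by simp
  qed
  then have "{x \<in> rl_max m \<sigma>. i \<le> x} = rl_max m \<sigma>" by auto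
  moreover have "i \<notin> Suc ` rl_max m \<sigma>" using \<open>\<And>x. x \<in> rl_max m \<sigma> \<Longrightarrow> i \<le> x\<close> by force
  ultimately show "card (rl_max (m + 2) (insert_cycle m i \<sigma>)) = card (rl_max m \<sigma>) + 1"
    unfolding rl_max_insert[OF s im(1,2)] by (simp add: card_image)
qed

text \<open>The descent at \<open>z\<close> is broken and replaced by one of the same kind: both
  cross exactly when \<open>\<sigma> (z + 1) < z + 1\<close>. Since
  \<open>\<sigma> m \<le> z\<close>, the last step is an ascent. The new maximum hides
  \<open>z\<close> and takes its place, so \<open>z\<close> is still counted in its rank.\<close>

lemma insert_rl_max_stats:
  assumes s: "involution_on m \<sigma>" and z: "z \<in> rl_max m \<sigma>"
  shows "card (noncrossing_descents (m + 2) (insert_cycle m (Suc z) \<sigma>)) = card (noncrossing_descents m \<sigma>)"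
    and "card (crossing_descents (m + 2) (insert_cycle m (Suc z) \<sigma>)) = card (crossing_descents m \<sigma>)"
    and "card (lr_max (m + 2) (insert_cycle m (Suc z) \<sigma>)) = card (lr_max m \<sigma>) + 1"
    and "card (rl_max (m + 2) (insert_cycle m (Suc z) \<sigma>)) = card {x \<in> rl_max m \<sigma>. z \<le> x}"
proof -
  have zm: "1 \<le> z" "z < \<sigma> z" "z \<le> m" and mx: "\<And>y. z < y \<Longrightarrow> y \<le> m \<Longrightarrow> \<sigma> y < \<sigma> z"
    using z by (auto simp: rl_max_def)
  have im: "1 \<le> Suc z" "Suc z \<le> m + 1" "Suc z \<le> m"
    using involution_on_range[OF s, of z] zm by auto
  have last: "\<sigma> m \<le> z"
    using rl_max_sentinel[OF s z, of m] involution_on_range[OF s zm(1,3)] involution_on_involutive[OF s, of z]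
    by (cases "\<sigma> z = m") auto
  have *: "card {x\<in>{1..<m + 2}. adjacent_descent c (insert_cycle m (Suc z) \<sigma>) x} =
      card {x\<in>{1..<m}. adjacent_descent c \<sigma> x}" for c
    using card_adjacent_descent_insert[OF s im(1,2), of c] mx[of "Suc z"] last im zm
    by (auto simp: adjacent_descent_def crosses_diagonal_def)
  show "card (noncrossing_descents (m + 2) (insert_cycle m (Suc z) \<sigma>)) = card (noncrossing_descents m \<sigma>)"
    "card (crossing_descents (m + 2) (insert_cycle m (Suc z) \<sigma>)) = card (crossing_descents m \<sigma>)"
    unfolding crossing_descents_eq noncrossing_descents_eq * by simp_all
  have "x \<le> z" if "x \<in> lr_max m \<sigma>" for x
  proof (rule ccontr)
    assume "\<not> x \<le> z"
    then have "\<sigma> z < \<sigma> x" "\<sigma> x < \<sigma> z" using that mx[of x] zm by (auto simp: lr_max_def)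
    then show False by simp
  qed
  then have "{x \<in> lr_max m \<sigma>. x < Suc z} = lr_max m \<sigma>" "Suc z \<notin> lr_max m \<sigma>" by force+
  then show "card (lr_max (m + 2) (insert_cycle m (Suc z) \<sigma>)) = card (lr_max m \<sigma>) + 1"
    unfolding lr_max_insert[OF s im(1,2)] by simp
  have "{x \<in> rl_max m \<sigma>. z \<le> x} = insert z {x \<in> rl_max m \<sigma>. Suc z \<le> x}" using z by auto
  then have "card {x \<in> rl_max m \<sigma>. z \<le> x} = Suc (card {x \<in> rl_max m \<sigma>. Suc z \<le> x})" by simp
  moreover have "card (rl_max (m + 2) (insert_cycle m (Suc z) \<sigma>)) =
      Suc (card (Suc ` {x \<in> rl_max m \<sigma>. Suc z \<le> x}))"
    unfolding rl_max_insert[OF s im(1,2)] by (subst card_Un_disjoint) auto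
  ultimately show "card (rl_max (m + 2) (insert_cycle m (Suc z) \<sigma>)) = card {x \<in> rl_max m \<sigma>. z \<le> x}"
    by (simp add: card_image)
qed

lemma insert_end_stats:
  assumes s: "involution_on m \<sigma>"
  shows "card (noncrossing_descents (m + 2) (insert_cycle m (m + 1) \<sigma>)) = card (noncrossing_descents m \<sigma>)"
    and "card (crossing_descents (m + 2) (insert_cycle m (m + 1) \<sigma>)) = card (crossing_descents m \<sigma>) + 1"
    and "card (lr_max (m + 2) (insert_cycle m (m + 1) \<sigma>)) = card (lr_max m \<sigma>) + 1"
    and "card (rl_max (m + 2) (insert_cycle m (m + 1) \<sigma>)) = 1"
proof -
  have *: "card {x\<in>{1..<m + 2}. adjacent_descent c (insert_cycle m (m + 1) \<sigma>) x} =
      card {x\<in>{1..<m}. adjacent_descent c \<sigma> x} + of_bool c" for c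
    using card_adjacent_descent_insert[OF s, of "m + 1" c] by simp
  show "card (noncrossing_descents (m + 2) (insert_cycle m (m + 1) \<sigma>)) = card (noncrossing_descents m \<sigma>)"
    "card (crossing_descents (m + 2) (insert_cycle m (m + 1) \<sigma>)) = card (crossing_descents m \<sigma>) + 1"
    unfolding crossing_descents_eq noncrossing_descents_eq * by simp_all
  have "{x \<in> lr_max m \<sigma>. x < m + 1} = lr_max m \<sigma>" "m + 1 \<notin> lr_max m \<sigma>"
    by (auto simp: lr_max_def)
  then show "card (lr_max (m + 2) (insert_cycle m (m + 1) \<sigma>)) = card (lr_max m \<sigma>) + 1"
    by (subst lr_max_insert[OF s]) auto
  have "rl_max (m + 2) (insert_cycle m (m + 1) \<sigma>) = {m + 1} \<union> Suc ` {x \<in> rl_max m \<sigma>. m + 1 \<le> x}"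
    by (rule rl_max_insert[OF s]) simp_all
  also have "\<dots> = {m + 1}" by (auto simp: rl_max_def)
  finally show "card (rl_max (m + 2) (insert_cycle m (m + 1) \<sigma>)) = 1" by simp
qed

lemma append_fixed_point_stats:
  assumes s: "involution_on m \<sigma>"
  shows "card (noncrossing_descents (m + 1) \<sigma>) = card (noncrossing_descents m \<sigma>)"
    and "card (crossing_descents (m + 1) \<sigma>) = card (crossing_descents m \<sigma>)"
    and "card (lr_max (m + 1) \<sigma>) = card (lr_max m \<sigma>) + 1"
    and "card (rl_max (m + 1) \<sigma>) = 0"
    and "card (fixed_points (m + 1) \<sigma>) = card (fixed_points m \<sigma>) + 1"
proof -
  have fix1: "\<sigma> (Suc m) = Suc m" using involution_on_outside[OF s, of "Suc m"] by simp
  have rng: "\<sigma> x < Suc m" if "1 \<le> x" "x \<le> m" for x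
    using involution_on_range(2)[OF s that] by simp
  have "{x\<in>{1..<m + 1}. adjacent_descent c \<sigma> x} = {x\<in>{1..<m}. adjacent_descent c \<sigma> x}" for c
    using rng[of m] fix1 by (auto simp: adjacent_descent_def less_Suc_eq)
  then show "card (noncrossing_descents (m + 1) \<sigma>) = card (noncrossing_descents m \<sigma>)"
    "card (crossing_descents (m + 1) \<sigma>) = card (crossing_descents m \<sigma>)"
    unfolding crossing_descents_eq noncrossing_descents_eq by simp_all
  have "lr_max (m + 1) \<sigma> = insert (Suc m) (lr_max m \<sigma>)"
    using rng fix1 by (auto simp: lr_max_def le_Suc_eq)
  moreover have "Suc m \<notin> lr_max m \<sigma>" by (simp add: lr_max_def)
  ultimately show "card (lr_max (m + 1) \<sigma>) = card (lr_max m \<sigma>) + 1" by simp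
  have "x \<notin> rl_max (m + 1) \<sigma>" for x
  proof
    assume x: "x \<in> rl_max (m + 1) \<sigma>"
    then have "x \<noteq> Suc m" "1 \<le> x" "x \<le> m + 1" using fix1 by (auto simp: rl_max_def)
    then have "\<sigma> (Suc m) < \<sigma> x" "\<sigma> x < Suc m" using rng[of x] x by (auto simp: rl_max_def)
    then show False using fix1 by simp
  qed
  then have "rl_max (m + 1) \<sigma> = {}" by blast
  then show "card (rl_max (m + 1) \<sigma>) = 0" by simp
  have "fixed_points (m + 1) \<sigma> = insert (Suc m) (fixed_points m \<sigma>)"
    using fix1 by (auto simp: fixed_points_def)
  then show "card (fixed_points (m + 1) \<sigma>) = card (fixed_points m \<sigma>) + 1"
    by (simp add: fixed_points_def)
qed

lemma involutive_baxter_append_fixed_point_iff: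
  "involutive_baxter (m + 1) \<pi> \<and> \<pi> (m + 1) = m + 1 \<longleftrightarrow> involutive_baxter m \<pi>"
proof
  assume a: "involutive_baxter (m + 1) \<pi> \<and> \<pi> (m + 1) = m + 1"
  have "\<not> contains_2_41_3 m \<pi>" "\<not> contains_3_14_2 m \<pi>"
    using a unfolding involutive_baxter_iff contains_2_41_3_def contains_3_14_2_def
    by (meson le_add1 le_trans)+
  moreover have "involution_on m \<pi>"
    using a by (auto simp: involutive_baxter_iff involution_on_def not_le le_Suc_eq less_eq_Suc_le)
  ultimately show "involutive_baxter m \<pi>" by (simp add: involutive_baxter_iff)
next
  assume a: "involutive_baxter m \<pi>"
  then have s: "involution_on m \<pi>" by (simp add: involutive_baxter_iff)
  have f: "\<pi> (m + 1) = m + 1" using involution_on_outside[OF s, of "m + 1"] by simp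
  have rng: "\<pi> x < m + 1" if "1 \<le> x" "x \<le> m" for x
    using involution_on_range(2)[OF s that] by simp
  have "involution_on (m + 1) \<pi>" using s by (auto simp: involution_on_def)
  moreover have "\<not> contains_2_41_3 (m + 1) \<pi>"
  proof
    assume "contains_2_41_3 (m + 1) \<pi>"
    then obtain x j l where x: "1 \<le> x" "x < j" "j + 1 < l" "l \<le> m + 1"
        "\<pi> (j + 1) < \<pi> x" "\<pi> x < \<pi> l" "\<pi> l < \<pi> j"
      unfolding contains_2_41_3_def by blast
    then have "l \<noteq> m + 1" using rng[of j] f by auto
    then show False using a x contains_2_41_3I[of x j l m \<pi>] by (simp add: involutive_baxter_iff)
  qed
  moreover have "\<not> contains_3_14_2 (m + 1) \<pi>"
  proof
    assume "contains_3_14_2 (m + 1) \<pi>"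
    then obtain x j l where x: "1 \<le> x" "x < j" "j + 1 < l" "l \<le> m + 1"
        "\<pi> j < \<pi> l" "\<pi> l < \<pi> x" "\<pi> x < \<pi> (j + 1)"
      unfolding contains_3_14_2_def by blast
    then have "l \<noteq> m + 1" using rng[of x] f by auto
    then show False using a x contains_3_14_2I[of x j l m \<pi>] by (simp add: involutive_baxter_iff)
  qed
  ultimately show "involutive_baxter (m + 1) \<pi> \<and> \<pi> (m + 1) = m + 1"
    using f by (simp add: involutive_baxter_iff)
qed

section \<open>Walks on the labels\<close>

text \<open>The steps are transfer operators: \<open>f\<close> weights the labels reached, and the
  value at \<open>(a, b)\<close> sums these weights over the targets of one step.\<close>

definition left_step :: "(nat \<Rightarrow> nat \<Rightarrow> real) \<Rightarrow> nat \<Rightarrow> nat \<Rightarrow> real" where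
  "left_step f a b = (\<Sum>j=1..a. f j (b + 1))"

definition right_step :: "(nat \<Rightarrow> nat \<Rightarrow> real) \<Rightarrow> nat \<Rightarrow> nat \<Rightarrow> real" where
  "right_step f a b = (\<Sum>j=1..b. f (a + 1) j)"

definition fixed_step :: "(nat \<Rightarrow> nat \<Rightarrow> real) \<Rightarrow> nat \<Rightarrow> nat \<Rightarrow> real" where
  "fixed_step f a b = f (a + 1) 0"

definition end_step :: "(nat \<Rightarrow> nat \<Rightarrow> real) \<Rightarrow> nat \<Rightarrow> nat \<Rightarrow> real" where
  "end_step f a b = f (a + 1) 1"

text \<open>Total weight of all walks from \<open>(a, b)\<close> with the given numbers of left,
  right, fixed and end steps in any order. Absorbing an operator into \<open>f\<close> strips the
  last step, which matches deletion of the largest value.\<close>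

fun walks :: "nat \<Rightarrow> nat \<Rightarrow> nat \<Rightarrow> nat \<Rightarrow> (nat \<Rightarrow> nat \<Rightarrow> real) \<Rightarrow> nat \<Rightarrow> nat \<Rightarrow> real" where
  "walks k s p r f =
     (if k = 0 \<and> s = 0 \<and> p = 0 \<and> r = 0 then f
      else (\<lambda>a b.
        (if 0 < k then walks (k - 1) s p r (left_step f) a b else 0) +
        (if 0 < s then walks k (s - 1) p r (right_step f) a b else 0) +
        (if 0 < p then walks k s (p - 1) r (fixed_step f) a b else 0) +
        (if 0 < r then walks k s p (r - 1) (end_step f) a b else 0)))"

declare walks.simps [simp del]

lemma walks_0 [simp]: "walks 0 0 0 0 f = f"
  by (subst walks.simps) simp

lemma left_step_linear:
  "left_step (\<lambda>a b. f a b + g a b) = (\<lambda>a b. left_step f a b + left_step g a b)"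
  "left_step (\<lambda>a b. if P then f a b else 0) = (\<lambda>a b. if P then left_step f a b else 0)"
  by (auto simp: left_step_def sum.distrib fun_eq_iff)

lemma right_step_linear:
  "right_step (\<lambda>a b. f a b + g a b) = (\<lambda>a b. right_step f a b + right_step g a b)"
  "right_step (\<lambda>a b. if P then f a b else 0) = (\<lambda>a b. if P then right_step f a b else 0)"
  by (auto simp: right_step_def sum.distrib fun_eq_iff)

lemma fixed_step_linear:
  "fixed_step (\<lambda>a b. f a b + g a b) = (\<lambda>a b. fixed_step f a b + fixed_step g a b)"
  "fixed_step (\<lambda>a b. if P then f a b else 0) = (\<lambda>a b. if P then fixed_step f a b else 0)"
  by (auto simp: fixed_step_def fun_eq_iff)

lemma end_step_linear:
  "end_step (\<lambda>a b. f a b + g a b) = (\<lambda>a b. end_step f a b + end_step g a b)"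
  "end_step (\<lambda>a b. if P then f a b else 0) = (\<lambda>a b. if P then end_step f a b else 0)"
  by (auto simp: end_step_def fun_eq_iff)

text \<open>Stripping the first step instead gives a recursion in the starting label, the form that
  \<open>delayed\<close> has. Expanding once more from the other end, both recursions yield the same
  double sum, by linearity of the operators.\<close>

lemma walks_first_step:
  "0 < k + s + p + r \<Longrightarrow> walks k s p r f = (\<lambda>a b.
     (if 0 < k then left_step (walks (k - 1) s p r f) a b else 0) +
     (if 0 < s then right_step (walks k (s - 1) p r f) a b else 0) +
     (if 0 < p then fixed_step (walks k s (p - 1) r f) a b else 0) +
     (if 0 < r then end_step (walks k s p (r - 1) f) a b else 0))"
proof (induction "k + s + p + r" arbitrary: k s p r f rule: less_induct)
  case less
  show ?case
  proof (cases "k + s + p + r = 1")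
    case True
    then consider "k = 1" "s = 0" "p = 0" "r = 0" | "k = 0" "s = 1" "p = 0" "r = 0"
      | "k = 0" "s = 0" "p = 1" "r = 0" | "k = 0" "s = 0" "p = 0" "r = 1" by linarith
    then show ?thesis by cases (subst walks.simps, simp)+
  next
    case False
    then have "1 < k + s + p + r" using less.prems by linarith
    note last = walks.simps[of k s p r f]
    have k: "0 < k \<Longrightarrow> walks (k - 1) s p r g = (\<lambda>a b.
        (if 0 < k - 1 then left_step (walks (k - 1 - 1) s p r g) a b else 0) +
        (if 0 < s then right_step (walks (k - 1) (s - 1) p r g) a b else 0) +
        (if 0 < p then fixed_step (walks (k - 1) s (p - 1) r g) a b else 0) +
        (if 0 < r then end_step (walks (k - 1) s p (r - 1) g) a b else 0))" for g
      by (rule less.hyps) (use \<open>1 < k + s + p + r\<close> in auto)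
    have s: "0 < s \<Longrightarrow> walks k (s - 1) p r g = (\<lambda>a b.
        (if 0 < k then left_step (walks (k - 1) (s - 1) p r g) a b else 0) +
        (if 0 < s - 1 then right_step (walks k (s - 1 - 1) p r g) a b else 0) +
        (if 0 < p then fixed_step (walks k (s - 1) (p - 1) r g) a b else 0) +
        (if 0 < r then end_step (walks k (s - 1) p (r - 1) g) a b else 0))" for g
      by (rule less.hyps) (use \<open>1 < k + s + p + r\<close> in auto)
    have p: "0 < p \<Longrightarrow> walks k s (p - 1) r g = (\<lambda>a b.
        (if 0 < k then left_step (walks (k - 1) s (p - 1) r g) a b else 0) +
        (if 0 < s then right_step (walks k (s - 1) (p - 1) r g) a b else 0) +
        (if 0 < p - 1 then fixed_step (walks k s (p - 1 - 1) r g) a b else 0) +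
        (if 0 < r then end_step (walks k s (p - 1) (r - 1) g) a b else 0))" for g
      by (rule less.hyps) (use \<open>1 < k + s + p + r\<close> in auto)
    have r: "0 < r \<Longrightarrow> walks k s p (r - 1) g = (\<lambda>a b.
        (if 0 < k then left_step (walks (k - 1) s p (r - 1) g) a b else 0) +
        (if 0 < s then right_step (walks k (s - 1) p (r - 1) g) a b else 0) +
        (if 0 < p then fixed_step (walks k s (p - 1) (r - 1) g) a b else 0) +
        (if 0 < r - 1 then end_step (walks k s p (r - 1 - 1) g) a b else 0))" for g
      by (rule less.hyps) (use \<open>1 < k + s + p + r\<close> in auto)
    have k': "0 < k \<Longrightarrow> walks (k - 1) s p r f = (\<lambda>a b.
        (if 0 < k - 1 then walks (k - 1 - 1) s p r (left_step f) a b else 0) +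
        (if 0 < s then walks (k - 1) (s - 1) p r (right_step f) a b else 0) +
        (if 0 < p then walks (k - 1) s (p - 1) r (fixed_step f) a b else 0) +
        (if 0 < r then walks (k - 1) s p (r - 1) (end_step f) a b else 0))"
      using walks.simps[of "k - 1" s p r f] \<open>1 < k + s + p + r\<close> by auto
    have s': "0 < s \<Longrightarrow> walks k (s - 1) p r f = (\<lambda>a b.
        (if 0 < k then walks (k - 1) (s - 1) p r (left_step f) a b else 0) +
        (if 0 < s - 1 then walks k (s - 1 - 1) p r (right_step f) a b else 0) +
        (if 0 < p then walks k (s - 1) (p - 1) r (fixed_step f) a b else 0) +
        (if 0 < r then walks k (s - 1) p (r - 1) (end_step f) a b else 0))"
      using walks.simps[of k "s - 1" p r f] \<open>1 < k + s + p + r\<close> by auto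
    have p': "0 < p \<Longrightarrow> walks k s (p - 1) r f = (\<lambda>a b.
        (if 0 < k then walks (k - 1) s (p - 1) r (left_step f) a b else 0) +
        (if 0 < s then walks k (s - 1) (p - 1) r (right_step f) a b else 0) +
        (if 0 < p - 1 then walks k s (p - 1 - 1) r (fixed_step f) a b else 0) +
        (if 0 < r then walks k s (p - 1) (r - 1) (end_step f) a b else 0))"
      using walks.simps[of k s "p - 1" r f] \<open>1 < k + s + p + r\<close> by auto
    have r': "0 < r \<Longrightarrow> walks k s p (r - 1) f = (\<lambda>a b.
        (if 0 < k then walks (k - 1) s p (r - 1) (left_step f) a b else 0) +
        (if 0 < s then walks k (s - 1) p (r - 1) (right_step f) a b else 0) +
        (if 0 < p then walks k s (p - 1) (r - 1) (fixed_step f) a b else 0) +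
        (if 0 < r - 1 then walks k s p (r - 1 - 1) (end_step f) a b else 0))"
      using walks.simps[of k s p "r - 1" f] \<open>1 < k + s + p + r\<close> by auto
    have lhs: "walks k s p r f = (\<lambda>a b.
        (if 0 < k then walks (k - 1) s p r (left_step f) a b else 0) +
        (if 0 < s then walks k (s - 1) p r (right_step f) a b else 0) +
        (if 0 < p then walks k s (p - 1) r (fixed_step f) a b else 0) +
        (if 0 < r then walks k s p (r - 1) (end_step f) a b else 0))"
      using last \<open>1 < k + s + p + r\<close> by auto
    show ?thesis
    proof (intro ext)
      fix a b
      have K: "0 < k \<Longrightarrow> left_step (walks (k - 1) s p r f) a b =
          (if 0 < k - 1 then left_step (walks (k - 1 - 1) s p r (left_step f)) a b else 0) +
          (if 0 < s then left_step (walks (k - 1) (s - 1) p r (right_step f)) a b else 0) +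
          (if 0 < p then left_step (walks (k - 1) s (p - 1) r (fixed_step f)) a b else 0) +
          (if 0 < r then left_step (walks (k - 1) s p (r - 1) (end_step f)) a b else 0)"
        by (simp only: k' left_step_linear)
      have S: "0 < s \<Longrightarrow> right_step (walks k (s - 1) p r f) a b =
          (if 0 < k then right_step (walks (k - 1) (s - 1) p r (left_step f)) a b else 0) +
          (if 0 < s - 1 then right_step (walks k (s - 1 - 1) p r (right_step f)) a b else 0) +
          (if 0 < p then right_step (walks k (s - 1) (p - 1) r (fixed_step f)) a b else 0) +
          (if 0 < r then right_step (walks k (s - 1) p (r - 1) (end_step f)) a b else 0)"
        by (simp only: s' right_step_linear)
      have P: "0 < p \<Longrightarrow> fixed_step (walks k s (p - 1) r f) a b =
          (if 0 < k then fixed_step (walks (k - 1) s (p - 1) r (left_step f)) a b else 0) +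
          (if 0 < s then fixed_step (walks k (s - 1) (p - 1) r (right_step f)) a b else 0) +
          (if 0 < p - 1 then fixed_step (walks k s (p - 1 - 1) r (fixed_step f)) a b else 0) +
          (if 0 < r then fixed_step (walks k s (p - 1) (r - 1) (end_step f)) a b else 0)"
        by (simp only: p' fixed_step_linear)
      have R: "0 < r \<Longrightarrow> end_step (walks k s p (r - 1) f) a b =
          (if 0 < k then end_step (walks (k - 1) s p (r - 1) (left_step f)) a b else 0) +
          (if 0 < s then end_step (walks k (s - 1) p (r - 1) (right_step f)) a b else 0) +
          (if 0 < p then end_step (walks k s (p - 1) (r - 1) (fixed_step f)) a b else 0) +
          (if 0 < r - 1 then end_step (walks k s p (r - 1 - 1) (end_step f)) a b else 0)"
        by (simp only: r' end_step_linear)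
      note kk = k[of "left_step f", THEN fun_cong, THEN fun_cong, of a b]
        and ss = s[of "right_step f", THEN fun_cong, THEN fun_cong, of a b]
        and pp = p[of "fixed_step f", THEN fun_cong, THEN fun_cong, of a b]
        and rr = r[of "end_step f", THEN fun_cong, THEN fun_cong, of a b]
      show "walks k s p r f a b =
          (if 0 < k then left_step (walks (k - 1) s p r f) a b else 0) +
          (if 0 < s then right_step (walks k (s - 1) p r f) a b else 0) +
          (if 0 < p then fixed_step (walks k s (p - 1) r f) a b else 0) +
          (if 0 < r then end_step (walks k s p (r - 1) f) a b else 0)"
        unfolding lhs
        by (cases "0 < k"; cases "0 < s"; cases "0 < p"; cases "0 < r";
            simp only: kk ss pp rr K S P R if_True if_False add_0_left add_0_right simp_thms
              add.assoc add.commute add.left_commute)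
    qed
  qed
qed

section \<open>Delaying the right steps\<close>

text \<open>The parameter \<open>m\<close> counts reserved steps that raise only the first label.
  Right steps wait until all of these are used up; left steps may come in between.\<close>

fun delayed :: "nat \<Rightarrow> nat \<Rightarrow> nat \<Rightarrow> nat \<Rightarrow> nat \<Rightarrow> real" where
  "delayed m k s a b =
     (if m = 0 \<and> k = 0 \<and> s = 0 then 1
      else (if 0 < k then (\<Sum>j=1..a. delayed m (k - 1) s j (b + 1)) else 0) +
        (if 0 < m then delayed (m - 1) k s (a + 1) b
         else if 0 < s then (\<Sum>j=1..b. delayed 0 k (s - 1) (a + 1) j) else 0))"

declare delayed.simps [simp del]

text \<open>Left and reserved steps carry the surplus in the second label up to the first right
  step. That step then has one extra target, which keeps the second label and raises the first: it
  is one more reserved step.\<close>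

lemma delayed_diff:
  "delayed m k (Suc s) a (Suc b) - delayed m k (Suc s) a b = delayed (Suc m) k s a (Suc b)"
proof (induction "m + k" arbitrary: m k a b rule: less_induct)
  case less
  have L: "(if 0 < k then (\<Sum>j=1..a. delayed m (k - 1) (Suc s) j (Suc b + 1)) else 0) -
      (if 0 < k then (\<Sum>j=1..a. delayed m (k - 1) (Suc s) j (b + 1)) else 0) =
      (if 0 < k then (\<Sum>j=1..a. delayed (Suc m) (k - 1) s j (Suc b + 1)) else 0)"
    using less[of m "k - 1"] by (auto simp flip: sum_subtractf)
  have "0 < m \<Longrightarrow> delayed (m - 1) k (Suc s) (a + 1) (Suc b) - delayed (m - 1) k (Suc s) (a + 1) b
      = delayed m k s (a + 1) (Suc b)"
    using less[of "m - 1" k] by simp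
  then show ?case
    using L by (subst (1 2 3) delayed.simps) auto
qed

lemma delayed_0_const: "delayed m k 0 a b = delayed m k 0 a c"
proof (induction "m + k" arbitrary: m k a b c rule: less_induct)
  case less
  have "(\<Sum>j=1..a. delayed m (k - 1) 0 j (b + 1)) = (\<Sum>j=1..a. delayed m (k - 1) 0 j (c + 1))" if "0 < k"
    using less[of m "k - 1"] that by (intro sum.cong) auto
  moreover have "delayed (m - 1) k 0 (a + 1) b = delayed (m - 1) k 0 (a + 1) c" if "0 < m"
    using less[of "m - 1" k] that by auto
  ultimately show ?case by (subst (1 2) delayed.simps) auto
qed

text \<open>Right steps taken before a reserved step are traded for a larger starting label.\<close>

lemma delayed_telescope:
  "delayed m k s a b + (if 0 < s then (\<Sum>j=1..c. delayed (Suc m) k (s - 1) a (j + b)) else 0) =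
     delayed m k s a (c + b)"
proof (cases s)
  case 0
  then show ?thesis using delayed_0_const by simp
next
  case (Suc s')
  show ?thesis
  proof (induction c)
    case (Suc c)
    then show ?case using delayed_diff[of m k s' a "c + b"] \<open>s = Suc s'\<close> by simp
  qed simp
qed

text \<open>
  Shuffling the \<open>p\<close> fixed points and the \<open>r\<close> crossing descents in all ways is accounted for by
  the binomial coefficient: the remaining count behaves as if all \<open>p + r\<close> of them came first,
  without resetting the second label, which starts \<open>r\<close> higher instead.
\<close>

lemma walks_eq_delayed:
  "walks k s p r (\<lambda>_ _. 1) a b = real ((p + r) choose r) * delayed (p + r) k s a (b + r)"
proof (induction "k + s + p + r" arbitrary: k s p r a b rule: less_induct)
  case less
  show ?case
  proof (cases "k + s + p + r = 0")
    case True
    then show ?thesis by (simp add: delayed.simps)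
  next
    case False
    \<comment> \<open>A fixed step leads to second label 0 with \<open>r\<close> end steps left, an
      end step to label 1 with \<open>r - 1\<close> left. The shifted label is \<open>r\<close> in
      both cases, so the two coefficients add up by Pascal's rule.\<close>
    have E: "(if 0 < p then fixed_step (walks k s (p - 1) r (\<lambda>_ _. 1)) a b else 0) +
        (if 0 < r then end_step (walks k s p (r - 1) (\<lambda>_ _. 1)) a b else 0) =
        (if 0 < p + r then real ((p + r) choose r) * delayed (p + r - 1) k s (a + 1) r else 0)"
    proof (cases p; cases r)
      fix p' r' assume "p = Suc p'" "r = Suc r'"
      then show ?thesis
        using less[of k s p' r] less[of k s p r']
        by (simp add: fixed_step_def end_step_def algebra_simps)
    qed (use less[of k s "p - 1" r] less[of k s p "r - 1"] in
        \<open>auto simp: fixed_step_def end_step_def\<close>)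
    have L: "(if 0 < k then left_step (walks (k - 1) s p r (\<lambda>_ _. 1)) a b else 0) =
        real ((p + r) choose r) * (if 0 < k then (\<Sum>j=1..a. delayed (p + r) (k - 1) s j (b + r + 1)) else 0)"
      using less[of "k - 1" s p r] by (auto simp: left_step_def sum_distrib_left)
    have R: "(if 0 < s then right_step (walks k (s - 1) p r (\<lambda>_ _. 1)) a b else 0) =
        real ((p + r) choose r) * (if 0 < s then (\<Sum>j=1..b. delayed (p + r) k (s - 1) (a + 1) (j + r)) else 0)"
      using less[of k "s - 1" p r] by (auto simp: right_step_def sum_distrib_left)
    show ?thesis
    proof (cases "p + r = 0")
      case True
      then show ?thesis
        using False L R E by (subst walks_first_step, simp, subst (1) delayed.simps) (simp add: add.commute)
    next
      case pr: False
      then obtain m where m: "p + r = Suc m" by (cases "p + r") auto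
      let ?c = "real ((p + r) choose r)"
      let ?l = "if 0 < k then (\<Sum>j=1..a. delayed (p + r) (k - 1) s j (b + r + 1)) else 0"
      let ?r = "if 0 < s then (\<Sum>j=1..b. delayed (p + r) k (s - 1) (a + 1) (j + r)) else 0"
      have "walks k s p r (\<lambda>_ _. 1) a b = ?c * ?l + ?c * ?r + ?c * delayed m k s (a + 1) r"
        using False L R E m by (subst walks_first_step) (simp_all only: add.assoc, simp_all)
      also have "\<dots> = ?c * (?l + (delayed m k s (a + 1) r + ?r))"
        by (simp only: distrib_left ac_simps)
      \<comment> \<open>The reset puts the shifted label at \<open>r\<close>; the right steps
        available now lift it back to \<open>b + r\<close>.\<close>
      also have "delayed m k s (a + 1) r + ?r = delayed m k s (a + 1) (b + r)"
        using delayed_telescope[of m k s "a + 1" r b] by (simp only: m)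
      also have "?l + delayed m k s (a + 1) (b + r) = delayed (p + r) k s a (b + r)"
        using m by (subst (2) delayed.simps) simp
      finally show ?thesis .
    qed
  qed
qed

section \<open>The determinant of binomial coefficients\<close>

text \<open>Integer lower indices make Pascal's rule and the shifts of rows hold without side
  conditions.\<close>

definition binom :: "nat \<Rightarrow> int \<Rightarrow> real" where
  "binom n j = (if j < 0 then 0 else real (n choose nat j))"

lemma binom_Suc: "binom (Suc n) j = binom n j + binom n (j - 1)"
proof (cases "j \<le> 0")
  case False
  then obtain i where "nat j = Suc i" "nat (j - 1) = i" by (cases "nat j") auto
  with False show ?thesis by (simp add: binom_def)
qed (auto simp: binom_def)

lemma binom_neg [simp]: "j < 0 \<Longrightarrow> binom n j = 0"
  by (simp add: binom_def)

lemma binom_0 [simp]: "binom n 0 = 1"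
  by (simp add: binom_def)

lemma binom_symmetric: "binom n j = binom n (int n - j)"
proof (cases "0 \<le> j \<and> j \<le> int n")
  case True
  then have "nat (int n - j) = n - nat j" "nat j \<le> n" by auto
  with True show ?thesis using binomial_symmetric[of "nat j" n] by (simp add: binom_def)
qed (auto simp: binom_def)

lemma binom_absorb: "(of_int j + 1) * binom n (j + 1) = (real n - of_int j) * binom n j"
proof (cases "j < 0")
  case True
  then show ?thesis by (cases "j = -1") (auto simp: binom_def)
next
  case False
  then obtain i where j: "j = int i" by (metis nonneg_int_cases not_le)
  have "Suc i * (n choose Suc i) = (n - i) * (n choose i)"
    by (simp only: binomial_absorb_comp binomial_absorption)
  then have "real (Suc i) * real (n choose Suc i) = real (n - i) * real (n choose i)"
    by (metis of_nat_mult)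
  then show ?thesis
    using j by (cases "i \<le> n") (auto simp: binom_def nat_add_distrib algebra_simps of_nat_diff)
qed

text \<open>
  The Lindstroem--Gessel--Viennot determinant with rows \<open>binom x (k - j)\<close>,
  \<open>binom y (k + 1 - j)\<close>, \<open>binom z (s - 2 + j)\<close> for \<open>j = 0, 1, 2\<close>.
\<close>

definition path_det :: "nat \<Rightarrow> nat \<Rightarrow> nat \<Rightarrow> int \<Rightarrow> int \<Rightarrow> real" where
  "path_det x y z k s =
     binom x k * (binom y k * binom z s - binom y (k - 1) * binom z (s - 1))
     - binom x (k - 1) * (binom y (k + 1) * binom z s - binom y (k - 1) * binom z (s - 2))
     + binom x (k - 2) * (binom y (k + 1) * binom z (s - 1) - binom y k * binom z (s - 2))"

lemma path_det_neg [simp]: "k < 0 \<Longrightarrow> path_det x y z k s = 0"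
  by (simp add: path_det_def)

text \<open>Pascal's rule adds to a row its shift. Both sides expand to twice the determinant for
  \<open>x\<close>, \<open>y\<close>, plus those with either row shifted, plus that with both
  shifted, which is the one for \<open>k - 1\<close>.\<close>

lemma path_det_Suc_xy:
  "path_det (Suc x) (Suc y) z k s + path_det x y z k s =
     path_det x (Suc y) z k s + path_det x y z (k - 1) s + path_det (Suc x) y z k s"
  by (simp add: path_det_def binom_Suc algebra_simps)

text \<open>The second row for \<open>Suc y\<close> is the second row for \<open>y\<close> plus the
  first row.\<close>

lemma path_det_eq_rows: "path_det y (Suc y) z k s = path_det y y z k s"
  by (simp add: path_det_def binom_Suc algebra_simps)

lemma path_det_Suc_z: "path_det x y (Suc z) k s = path_det x y z k s + path_det x y z k (s - 1)"
  by (simp add: path_det_def binom_Suc algebra_simps)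

text \<open>At \<open>s = 0\<close> the third row is \<open>(0, 0, 1)\<close>, whatever its
  size.\<close>

lemma path_det_s0: "path_det x y z k 0 = path_det x y z' k 0"
  by (simp add: path_det_def)

text \<open>In this situation the third row is the second row for \<open>y = z\<close>, which causes
  the cancellations at the boundary.\<close>

lemma binom_symmetric_row:
  assumes "k + s = int z + 1"
  shows "binom z s = binom z (k - 1)" "binom z (s - 1) = binom z k" "binom z (s - 2) = binom z (k + 1)"
  using assms by (subst binom_symmetric, intro arg_cong[where f = "binom z"], simp)+

text \<open>The second row is the sum of the other two.\<close>

lemma path_det_antisym:
  assumes "k + s = int z + 1"
  shows "path_det z (Suc z) z k s = 0"
  unfolding path_det_def binom_symmetric_row[OF assms]
  by (simp add: binom_Suc algebra_simps)

text \<open>In the term with the shifted first row, Pascal's rule splits the second row; one part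
  equals the third row and drops out.\<close>

lemma path_det_Suc_x_antisym:
  assumes "k + s = int z + 1"
  shows "path_det (Suc x) (Suc z) z k s = path_det x (Suc z) z k s + path_det x z z (k - 1) s"
  unfolding path_det_def binom_symmetric_row[OF assms]
  by (simp add: binom_Suc algebra_simps)

section \<open>The determinant satisfies the recursion of \<open>delayed\<close>\<close>

text \<open>The labels \<open>a\<close> and \<open>b\<close> enter only as offsets of the first and
  third row. The subtractions truncate only when \<open>k = s = 0\<close>, and then the affected row
  does not depend on its size.\<close>

definition path_count :: "nat \<Rightarrow> nat \<Rightarrow> nat \<Rightarrow> nat \<Rightarrow> nat \<Rightarrow> real" where
  "path_count m k s a b = path_det (s + m + a + k - 1) (s + m + k) (s + k + b - 1) (int k) (int s)"

lemma path_count_diff: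
  "path_count m k (Suc s) a (Suc b) = path_count m k (Suc s) a b + path_count (Suc m) k s a (Suc b)"
  using path_det_Suc_z[of "s + m + a + k" "Suc (s + m + k)" "s + k + b" "int k" "int (Suc s)"]
  by (simp add: path_count_def)

lemma path_count_s0: "path_count m k 0 a b = path_count m k 0 a b'"
  unfolding path_count_def of_nat_0 by (rule path_det_s0)

text \<open>Differencing in \<open>a\<close> removes the sum and leaves
  \<open>path_det_Suc_xy\<close>; at \<open>a = 0\<close> the two remaining determinants agree by
  \<open>path_det_eq_rows\<close>.\<close>

lemma path_count_Suc:
  "path_count (Suc m) k s a b =
     (if 0 < k then (\<Sum>j=1..a. path_count (Suc m) (k - 1) s j (b + 1)) else 0) +
     path_count m k s (a + 1) b"
proof (induction a)
  case 0
  show ?case using path_det_eq_rows[of "s + m + k"] by (simp add: path_count_def)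
next
  case (Suc a)
  have "path_count (Suc m) k s (Suc a) b + path_count m k s (Suc a) b =
      path_count (Suc m) k s a b + (if 0 < k then path_count (Suc m) (k - 1) s (Suc a) (b + 1) else 0)
      + path_count m k s (Suc (Suc a)) b"
    using path_det_Suc_xy[of "s + m + a + k" "s + m + k" "s + k + b - 1" "int k" "int s"]
    by (cases k) (simp_all add: path_count_def)
  with Suc show ?case by (auto simp: algebra_simps)
qed

text \<open>At \<open>b = 0\<close> no right step is possible. The third row then has size
  \<open>k + s - 1\<close>, just what the reversal symmetry requires.\<close>

lemma path_count_0_0:
  assumes "0 < k + s"
  shows "path_count 0 k s a 0 = (if 0 < k then (\<Sum>j=1..a. path_count 0 (k - 1) s j 1) else 0)"
proof -
  obtain z where z: "k + s = Suc z" using assms by (cases "k + s") auto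
  then have zi: "int k + int s = int z + 1" by simp
  show ?thesis
  proof (induction a)
    case 0
    show ?case using path_det_antisym[OF zi] z by (simp add: path_count_def add.commute)
  next
    case (Suc a)
    have eqs: "s + 0 + Suc a + k - 1 = Suc (z + a)" "s + 0 + k = Suc z" "s + k + 0 - 1 = z"
        "s + 0 + a + k - 1 = z + a"
      using z by auto
    have "path_count 0 k s (Suc a) 0 = path_count 0 k s a 0 +
        (if 0 < k then path_count 0 (k - 1) s (Suc a) 1 else 0)"
    proof (cases k)
      case 0
      then show ?thesis
        using path_det_Suc_x_antisym[OF zi, of "z + a"] unfolding path_count_def eqs by simp
    next
      case (Suc k')
      then have eqs': "s + a + k' = z + a" "s + k' = z"
        using z by auto
      have "int k' = int k - 1" using Suc by simp
      then show ?thesis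
        using path_det_Suc_x_antisym[OF zi, of "z + a"] unfolding path_count_def eqs by (simp add: Suc eqs')
    qed
    with Suc show ?case by simp
  qed
qed

text \<open>Raising \<open>b\<close> adds, by \<open>path_count_diff\<close>, a term with one
  reserved step; \<open>path_count_Suc\<close> splits it into the change of the left sum and the new
  summand of the right sum.\<close>

lemma path_count_0:
  assumes "0 < k + s"
  shows "path_count 0 k s a b =
     (if 0 < k then (\<Sum>j=1..a. path_count 0 (k - 1) s j (b + 1)) else 0) +
     (if 0 < s then (\<Sum>j=1..b. path_count 0 k (s - 1) (a + 1) j) else 0)"
proof (cases s)
  case 0
  have "path_count 0 k 0 a b = path_count 0 k 0 a 0" by (rule path_count_s0)
  also have "\<dots> = (\<Sum>j=1..a. path_count 0 (k - 1) 0 j 1)" using path_count_0_0[OF assms, of a] 0 assms by simp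
  also have "\<dots> = (\<Sum>j=1..a. path_count 0 (k - 1) 0 j (b + 1))" by (intro sum.cong path_count_s0 refl)
  finally show ?thesis using 0 assms by simp
next
  case (Suc s')
  show ?thesis
  proof (induction b)
    case 0
    then show ?case using path_count_0_0[OF assms, of a] by simp
  next
    case (Suc b)
    then show ?case
      using \<open>s = Suc s'\<close> path_count_Suc[of 0 k s' a "Suc b"]
      by (simp add: path_count_diff sum.distrib)
  qed
qed

lemma delayed_eq_path_count: "delayed m k s a b = path_count m k s a b"
proof (induction "m + k + s" arbitrary: m k s a b rule: less_induct)
  case less
  consider "m = 0" "k = 0" "s = 0" | "m = 0" "0 < k + s" | m' where "m = Suc m'" by (cases m) auto
  then show ?case
  proof cases
    case 1
    then show ?thesis by (simp add: delayed.simps path_count_def path_det_def binom_def)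
  next
    case 2
    then show ?thesis
      using less path_count_0[OF 2(2), of a b] by (subst delayed.simps) simp
  next
    case (3 m')
    then show ?thesis
      using less path_count_Suc[of m' k s a b] by (subst delayed.simps) simp
  qed
qed

section \<open>The generating tree\<close>

text \<open>With an arbitrary weight, deleting the largest value becomes a change of weight.\<close>

definition stat_sum :: "nat \<Rightarrow> (nat \<Rightarrow> nat \<Rightarrow> nat \<Rightarrow> nat \<Rightarrow> nat \<Rightarrow> real) \<Rightarrow> real" where
  "stat_sum N \<Phi> = (\<Sum>\<pi> | involutive_baxter N \<pi>.
     \<Phi> (card (lr_max N \<pi>)) (card (rl_max N \<pi>)) (card (noncrossing_descents N \<pi>))
       (card (fixed_points N \<pi>)) (card (crossing_descents N \<pi>)))"

lemma finite_involutive_baxter [simp]: "finite {\<pi>. involutive_baxter N \<pi>}"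
  by (rule finite_subset[OF _ finite_permutations[of "{1..N}"]])
    (auto simp: involutive_baxter_def baxter_def)

lemma stat_sum_0: "stat_sum 0 \<Phi> = \<Phi> 0 0 0 0 0"
proof -
  have "{\<pi>. involutive_baxter 0 \<pi>} = {id}"
    by (auto simp: involutive_baxter_iff involution_on_def contains_2_41_3_def contains_3_14_2_def fun_eq_iff)
  then show ?thesis
    by (simp add: stat_sum_def lr_max_def rl_max_def noncrossing_descents_def crossing_descents_def
        descents_def fixed_points_def)
qed

lemma sum_append_fixed_point:
  "(\<Sum>\<pi> | involutive_baxter (m + 1) \<pi> \<and> \<pi> (m + 1) = m + 1.
     \<Phi> (card (lr_max (m + 1) \<pi>)) (card (rl_max (m + 1) \<pi>)) (card (noncrossing_descents (m + 1) \<pi>))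
       (card (fixed_points (m + 1) \<pi>)) (card (crossing_descents (m + 1) \<pi>))) =
   stat_sum m (\<lambda>a b k p r. \<Phi> (a + 1) 0 k (p + 1) r)"
  unfolding involutive_baxter_append_fixed_point_iff stat_sum_def
  by (intro sum.cong refl) (simp add: append_fixed_point_stats[unfolded Suc_eq_plus1[symmetric]] involutive_baxter_iff)

lemma stat_sum_1: "stat_sum 1 \<Phi> = stat_sum 0 (\<lambda>a b k p r. \<Phi> (a + 1) 0 k (p + 1) r)"
proof -
  have "\<pi> 1 = 1" if "involutive_baxter 1 \<pi>" for \<pi>
    using that involution_on_range[of 1 \<pi> 1] by (simp add: involutive_baxter_iff)
  then have "stat_sum 1 \<Phi> = (\<Sum>\<pi> | involutive_baxter (0 + 1) \<pi> \<and> \<pi> (0 + 1) = 0 + 1.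
     \<Phi> (card (lr_max (0 + 1) \<pi>)) (card (rl_max (0 + 1) \<pi>)) (card (noncrossing_descents (0 + 1) \<pi>))
       (card (fixed_points (0 + 1) \<pi>)) (card (crossing_descents (0 + 1) \<pi>)))"
    unfolding stat_sum_def by (intro sum.cong) auto
  also note sum_append_fixed_point
  finally show ?thesis .
qed

lemma nonfixed_last_eq:
  "{\<pi>. involutive_baxter (m + 2) \<pi> \<and> \<pi> (m + 2) \<noteq> m + 2} =
     (\<lambda>(\<sigma>, i). insert_cycle m i \<sigma>) ` (SIGMA \<sigma>:{\<sigma>. involutive_baxter m \<sigma>}. sites m \<sigma>)" (is "?L = ?R")
proof (intro set_eqI iffI)
  fix \<pi> assume a: "\<pi> \<in> ?L"
  then have p: "involution_on (m + 2) \<pi>" by (simp add: involutive_baxter_iff)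
  define i where "i = \<pi> (m + 2)"
  have i: "i \<le> m + 1" using involution_on_range(2)[OF p, of "m + 2"] a by (simp add: i_def)
  note d = involution_on_delete[OF p i_def[symmetric] i]
  have "involutive_baxter (m + 2) (insert_cycle m i (delete_cycle m i \<pi>))"
    using a by (simp only: d(3)[symmetric] mem_Collect_eq)
  then have "involutive_baxter m (delete_cycle m i \<pi>) \<and> i \<in> sites m (delete_cycle m i \<pi>)"
    using involutive_baxter_insert_iff[OF d(2,1) i] by simp
  then have "(delete_cycle m i \<pi>, i) \<in> (SIGMA \<sigma>:{\<sigma>. involutive_baxter m \<sigma>}. sites m \<sigma>)"
    by simp
  then show "\<pi> \<in> ?R"
    by (rule rev_image_eqI) (simp only: prod.case d(3)[symmetric])
next
  fix \<pi> assume "\<pi> \<in> ?R"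
  then obtain \<sigma> i where si: "\<pi> = insert_cycle m i \<sigma>" "involutive_baxter m \<sigma>" "i \<in> sites m \<sigma>" by auto
  then have "involution_on m \<sigma>" "1 \<le> i" "i \<le> m + 1"
    using sites_bounds by (auto simp: involutive_baxter_iff)
  then show "\<pi> \<in> ?L" using si involutive_baxter_insert_iff[of m \<sigma> i] by simp
qed

lemma inj_on_insert_cycle:
  "inj_on (\<lambda>(\<sigma>, i). insert_cycle m i \<sigma>) (SIGMA \<sigma>:{\<sigma>. involutive_baxter m \<sigma>}. sites m \<sigma>)"
proof (rule inj_onI, clarify)
  fix \<sigma> i \<tau> j
  assume s: "involutive_baxter m \<sigma>" "i \<in> sites m \<sigma>" and t: "involutive_baxter m \<tau>" "j \<in> sites m \<tau>"
    and eq: "insert_cycle m i \<sigma> = insert_cycle m j \<tau>"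
  have ib: "1 \<le> i" "i \<le> m + 1" "1 \<le> j" "j \<le> m + 1" using sites_bounds s(2) t(2) by blast+
  have "i = insert_cycle m i \<sigma> (Suc (Suc m))" using ib by simp
  also have "\<dots> = j" unfolding eq using ib by simp
  finally have ij: "i = j" .
  have "\<sigma> = delete_cycle m i (insert_cycle m i \<sigma>)"
    by (rule delete_insert_cycle[symmetric]) (use s ib in \<open>simp_all add: involutive_baxter_iff\<close>)
  also have "\<dots> = delete_cycle m i (insert_cycle m j \<tau>)" by (simp only: eq)
  also have "\<dots> = \<tau>"
    unfolding ij by (rule delete_insert_cycle) (use t ib in \<open>simp_all add: involutive_baxter_iff\<close>)
  finally show "\<sigma> = \<tau> \<and> i = j" using ij by simp
qed

lemma stat_sum_Suc_Suc:
  "stat_sum (m + 2) \<Phi> = stat_sum (m + 1) (\<lambda>a b k p r. \<Phi> (a + 1) 0 k (p + 1) r) +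
     stat_sum m (\<lambda>a b k p r. (\<Sum>j=1..a. \<Phi> j (b + 1) (k + 2) p r) +
       (\<Sum>j=1..b. \<Phi> (a + 1) j k p r) + \<Phi> (a + 1) 1 k p (r + 1))"
proof -
  let ?F = "\<lambda>N \<pi>. \<Phi> (card (lr_max N \<pi>)) (card (rl_max N \<pi>)) (card (noncrossing_descents N \<pi>))
    (card (fixed_points N \<pi>)) (card (crossing_descents N \<pi>))"
  let ?A = "{\<pi>. involutive_baxter (m + 2) \<pi> \<and> \<pi> (m + 2) = m + 2}"
  let ?B = "{\<pi>. involutive_baxter (m + 2) \<pi> \<and> \<pi> (m + 2) \<noteq> m + 2}"
  have fin: "finite ?A" "finite ?B"
    by (rule finite_subset[OF _ finite_involutive_baxter[of "m + 2"]], blast)+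
  have "stat_sum (m + 2) \<Phi> = sum (?F (m + 2)) (?A \<union> ?B)"
    unfolding stat_sum_def by (intro sum.cong refl) blast
  also have "\<dots> = sum (?F (m + 2)) ?A + sum (?F (m + 2)) ?B"
    by (rule sum.union_disjoint[OF fin]) blast
  finally have split: "stat_sum (m + 2) \<Phi> = sum (?F (m + 2)) ?A + sum (?F (m + 2)) ?B" .
  have A: "sum (?F (m + 2)) ?A = stat_sum (m + 1) (\<lambda>a b k p r. \<Phi> (a + 1) 0 k (p + 1) r)"
    using sum_append_fixed_point[where m = "m + 1" and \<Phi> = \<Phi>]
    by (simp only: add.assoc one_add_one)
  have inner: "(\<Sum>i\<in>sites m \<sigma>. ?F (m + 2) (insert_cycle m i \<sigma>)) =
      (\<Sum>j=1..card (lr_max m \<sigma>). \<Phi> j (card (rl_max m \<sigma>) + 1) (card (noncrossing_descents m \<sigma>) + 2)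
        (card (fixed_points m \<sigma>)) (card (crossing_descents m \<sigma>))) +
      (\<Sum>j=1..card (rl_max m \<sigma>). \<Phi> (card (lr_max m \<sigma>) + 1) j (card (noncrossing_descents m \<sigma>))
        (card (fixed_points m \<sigma>)) (card (crossing_descents m \<sigma>))) +
      \<Phi> (card (lr_max m \<sigma>) + 1) 1 (card (noncrossing_descents m \<sigma>))
        (card (fixed_points m \<sigma>)) (card (crossing_descents m \<sigma>) + 1)"
    if "involutive_baxter m \<sigma>" for \<sigma>
  proof -
    have s: "involution_on m \<sigma>" using that by (simp add: involutive_baxter_iff)
    have fp: "card (fixed_points (m + 2) (insert_cycle m i \<sigma>)) = card (fixed_points m \<sigma>)"
      if "i \<in> sites m \<sigma>" for i
      using card_fixed_points_insert[OF s] sites_bounds[OF that] by simp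
    have "(\<Sum>i\<in>lr_max m \<sigma>. ?F (m + 2) (insert_cycle m i \<sigma>)) =
        (\<Sum>i\<in>lr_max m \<sigma>. \<Phi> (card {x \<in> lr_max m \<sigma>. x \<le> i}) (card (rl_max m \<sigma>) + 1)
          (card (noncrossing_descents m \<sigma>) + 2) (card (fixed_points m \<sigma>)) (card (crossing_descents m \<sigma>)))"
      by (intro sum.cong refl, subst fp) (simp_all only: insert_lr_max_stats[OF s] sites_def Un_iff simp_thms)
    also have "\<dots> = (\<Sum>j=1..card (lr_max m \<sigma>). \<Phi> j (card (rl_max m \<sigma>) + 1)
          (card (noncrossing_descents m \<sigma>) + 2) (card (fixed_points m \<sigma>)) (card (crossing_descents m \<sigma>)))"
      by (rule sum_card_le_eq) simp
    finally have 1: "(\<Sum>i\<in>lr_max m \<sigma>. ?F (m + 2) (insert_cycle m i \<sigma>)) = \<dots>" .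
    have "(\<Sum>z\<in>rl_max m \<sigma>. ?F (m + 2) (insert_cycle m (Suc z) \<sigma>)) =
        (\<Sum>z\<in>rl_max m \<sigma>. \<Phi> (card (lr_max m \<sigma>) + 1) (card {x \<in> rl_max m \<sigma>. z \<le> x})
          (card (noncrossing_descents m \<sigma>)) (card (fixed_points m \<sigma>)) (card (crossing_descents m \<sigma>)))"
      by (intro sum.cong refl, subst fp)
        (simp_all only: insert_rl_max_stats[OF s] sites_def Un_iff simp_thms imageI)
    also have "\<dots> = (\<Sum>j=1..card (rl_max m \<sigma>). \<Phi> (card (lr_max m \<sigma>) + 1) j
          (card (noncrossing_descents m \<sigma>)) (card (fixed_points m \<sigma>)) (card (crossing_descents m \<sigma>)))"
      by (rule sum_card_ge_eq) simp
    finally have 2: "(\<Sum>z\<in>rl_max m \<sigma>. ?F (m + 2) (insert_cycle m (Suc z) \<sigma>)) = \<dots>" .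
    have e: "m + 1 \<in> sites m \<sigma>" by (simp add: sites_def)
    show ?thesis
      unfolding sum_sites[OF s] 1 2 insert_end_stats[OF s] fp[OF e] ..
  qed
  have "sum (?F (m + 2)) ?B =
      (\<Sum>(\<sigma>, i)\<in>(SIGMA \<sigma>:{\<sigma>. involutive_baxter m \<sigma>}. sites m \<sigma>). ?F (m + 2) (insert_cycle m i \<sigma>))"
    unfolding nonfixed_last_eq sum.reindex[OF inj_on_insert_cycle] by (simp add: o_def case_prod_unfold)
  also have "\<dots> = (\<Sum>\<sigma> | involutive_baxter m \<sigma>. \<Sum>i\<in>sites m \<sigma>. ?F (m + 2) (insert_cycle m i \<sigma>))"
    by (rule sum.Sigma[symmetric]) (simp_all add: sites_def)
  also have "\<dots> = stat_sum m (\<lambda>a b k p r. (\<Sum>j=1..a. \<Phi> j (b + 1) (k + 2) p r) +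
       (\<Sum>j=1..b. \<Phi> (a + 1) j k p r) + \<Phi> (a + 1) 1 k p (r + 1))"
    unfolding stat_sum_def by (intro sum.cong refl) (simp only: mem_Collect_eq inner)
  finally show ?thesis unfolding split A by simp
qed

text \<open>Here \<open>k\<close> counts pairs, since noncrossing descents arise two at a
  time.\<close>

definition graded_sum :: "nat \<Rightarrow> nat \<Rightarrow> nat \<Rightarrow> nat \<Rightarrow> (nat \<Rightarrow> nat \<Rightarrow> real) \<Rightarrow> real" where
  "graded_sum N k p r f =
     stat_sum N (\<lambda>a b k' p' r'. if k' = 2 * k \<and> p' = p \<and> r' = r then f a b else 0)"

lemma stat_sum_add: "stat_sum N (\<lambda>a b k p r. \<Phi> a b k p r + \<Psi> a b k p r) = stat_sum N \<Phi> + stat_sum N \<Psi>"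
  by (simp add: stat_sum_def sum.distrib)

lemma stat_sum_zero: "stat_sum N (\<lambda>a b k p r. 0) = 0"
  by (simp add: stat_sum_def)

lemma graded_fixed_step:
  "stat_sum N (\<lambda>a b k' p' r'. if k' = 2 * k \<and> p' + 1 = p \<and> r' = r then f (a + 1) 0 else 0) =
     (if 0 < p then graded_sum N k (p - 1) r (fixed_step f) else 0)"
  by (cases p) (simp_all add: graded_sum_def fixed_step_def stat_sum_zero cong: if_cong)

lemma graded_cycle_step:
  "stat_sum N (\<lambda>a b k' p' r'.
      (\<Sum>j=1..a. if k' + 2 = 2 * k \<and> p' = p \<and> r' = r then f j (b + 1) else 0) +
      (\<Sum>j=1..b. if k' = 2 * k \<and> p' = p \<and> r' = r then f (a + 1) j else 0) +
      (if k' = 2 * k \<and> p' = p \<and> r' + 1 = r then f (a + 1) 1 else 0)) =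
    (if 0 < k then graded_sum N (k - 1) p r (left_step f) else 0) +
    graded_sum N k p r (right_step f) +
    (if 0 < r then graded_sum N k p (r - 1) (end_step f) else 0)"
proof -
  have 1: "(\<Sum>j=1..a. if P then g j else 0) = (if P then (\<Sum>j=1..a. g j) else 0)"
    for a P and g :: "nat \<Rightarrow> real" by simp
  have "stat_sum N (\<lambda>a b k' p' r'. if k' + 2 = 2 * k \<and> p' = p \<and> r' = r then (\<Sum>j=1..a. f j (b + 1)) else 0) =
      (if 0 < k then graded_sum N (k - 1) p r (left_step f) else 0)"
    by (cases k) (simp_all add: graded_sum_def left_step_def stat_sum_zero cong: if_cong)
  moreover have "stat_sum N (\<lambda>a b k' p' r'. if k' = 2 * k \<and> p' = p \<and> r' + 1 = r then f (a + 1) 1 else 0) =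
      (if 0 < r then graded_sum N k p (r - 1) (end_step f) else 0)"
    by (cases r) (simp_all add: graded_sum_def end_step_def stat_sum_zero cong: if_cong)
  ultimately show ?thesis
    unfolding 1 stat_sum_add by (simp add: graded_sum_def right_step_def cong: if_cong)
qed

lemma graded_sum_0:
  "graded_sum 0 k p r f = (if k = 0 \<and> p = 0 \<and> r = 0 then f 0 0 else 0)"
  by (simp add: graded_sum_def stat_sum_0)

lemma graded_sum_1:
  "graded_sum 1 k p r f = (if 0 < p then graded_sum 0 k (p - 1) r (fixed_step f) else 0)"
  unfolding graded_fixed_step[symmetric] by (subst graded_sum_def) (rule stat_sum_1)

lemma graded_sum_Suc_Suc:
  "graded_sum (m + 2) k p r f =
     (if 0 < p then graded_sum (m + 1) k (p - 1) r (fixed_step f) else 0) +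
     ((if 0 < k then graded_sum m (k - 1) p r (left_step f) else 0) +
      graded_sum m k p r (right_step f) +
      (if 0 < r then graded_sum m k p (r - 1) (end_step f) else 0))"
  unfolding graded_fixed_step[symmetric] graded_cycle_step[symmetric]
  by (subst graded_sum_def) (rule stat_sum_Suc_Suc)

lemma graded_sum_eq_0: "N < p \<Longrightarrow> graded_sum N k p r f = 0"
proof -
  assume "N < p"
  moreover have "card (fixed_points N \<pi>) \<le> N" for \<pi>
    using card_mono[of "{1..N}" "fixed_points N \<pi>"] by (simp add: fixed_points_def subset_iff)
  ultimately have "card (fixed_points N \<pi>) \<noteq> p" for \<pi> by (metis not_le)
  then show ?thesis by (simp add: graded_sum_def stat_sum_def)
qed

text \<open>Each of the \<open>n\<close> cycles enters by one left, right or end step, which leaves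
  \<open>n - k - r\<close> right steps; the empty permutation has labels
  \<open>(0, 0)\<close>.\<close>

lemma graded_sum_eq_walks:
  "graded_sum (2 * n + p) k p r f = (if k + r \<le> n then walks k (n - k - r) p r f 0 0 else 0)"
proof (induction "2 * n + p" arbitrary: n k p r f rule: less_induct)
  case less
  have "n = 0 \<and> p = 0 \<or> n = 0 \<and> p = 1 \<or> 2 * n + p = (2 * n + p - 2) + 2" by auto
  then consider "n = 0" "p = 0" | "n = 0" "p = 1" | m where "2 * n + p = m + 2" by blast
  then show ?case
  proof cases
    case 1
    then show ?thesis by (simp add: graded_sum_0)
  next
    case 2
    then show ?thesis
      using graded_sum_1[of k 1 r f] graded_sum_0 by (subst walks.simps) (simp add: graded_sum_0)
  next
    case (3 m)
    have F: "(if 0 < p then graded_sum (m + 1) k (p - 1) r (fixed_step f) else 0) =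
        (if 0 < p \<and> k + r \<le> n then walks k (n - k - r) (p - 1) r (fixed_step f) 0 0 else 0)"
    proof (cases "0 < p")
      case True
      then have e: "m + 1 = 2 * n + (p - 1)" using 3 by simp
      show ?thesis using less[of n "p - 1" k r "fixed_step f"] True unfolding e by simp
    qed simp
    show ?thesis
    proof (cases n)
      case 0
      \<comment> \<open>Without cycles the size \<open>m = p - 2\<close> has no room for
        \<open>p\<close> fixed points.\<close>
      have "graded_sum m k' p r' g = 0" for k' r' g
        using 0 3 by (intro graded_sum_eq_0) simp
      moreover have "walks k 0 p r f 0 0 = walks k 0 (p - 1) r (fixed_step f) 0 0" if "k = 0" "r = 0"
        using that 0 3 by (subst walks.simps) auto
      ultimately show ?thesis
        unfolding 3 graded_sum_Suc_Suc F using 0 3 by auto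
    next
      case (Suc n')
      then have e: "m = 2 * n' + p" using 3 by simp
      have IH: "graded_sum m k' p r' g = (if k' + r' \<le> n' then walks k' (n' - k' - r') p r' g 0 0 else 0)"
        for k' r' g unfolding e by (rule less) (simp add: Suc)
      have "graded_sum (m + 2) k p r f =
          (if k + r \<le> n then walks k (n - k - r) p r f 0 0 else 0)"
      proof (cases "k + r \<le> n")
        case True
        have "0 < k \<Longrightarrow> n' - (k - 1) - r = n - k - r" "0 < r \<Longrightarrow> n' - k - (r - 1) = n - k - r"
          "n' - k - r = n - k - r - 1" "k + r \<le> n' \<longleftrightarrow> 0 < n - k - r"
          using True Suc by auto
        then show ?thesis
          unfolding graded_sum_Suc_Suc F IH
          using True Suc by (subst (5) walks.simps) (auto; cases r; auto)
      next
        case False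
        then show ?thesis unfolding graded_sum_Suc_Suc F IH using Suc by auto
      qed
      then show ?thesis unfolding 3 .
    qed
  qed
qed

lemma num_involutive_baxter_eq:
  "real (num_involutive_baxter n k p r) =
     (if k + r \<le> n
      then real ((p + r) choose r) * path_det (n + p - 1) (n + p) (n - 1) (int k) (int (n - k - r))
      else 0)"
proof -
  let ?N = "2 * n + p"
  have "card (nonfixed_points ?N \<pi>) = 2 * n" if "card (fixed_points ?N \<pi>) = p" for \<pi>
  proof -
    have "nonfixed_points ?N \<pi> = {1..?N} - fixed_points ?N \<pi>"
      by (auto simp: nonfixed_points_def fixed_points_def)
    moreover have "fixed_points ?N \<pi> \<subseteq> {1..?N}" by (auto simp: fixed_points_def)
    ultimately show ?thesis using that by (simp add: card_Diff_subset finite_subset)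
  qed
  then have "involutive_baxter_set n k p r = {\<pi> \<in> {\<pi>. involutive_baxter ?N \<pi>}.
      card (noncrossing_descents ?N \<pi>) = 2 * k \<and> card (fixed_points ?N \<pi>) = p \<and>
      card (crossing_descents ?N \<pi>) = r}"
    unfolding involutive_baxter_set_def by blast
  then have "real (num_involutive_baxter n k p r) = graded_sum ?N k p r (\<lambda>_ _. 1)"
    unfolding num_involutive_baxter_def graded_sum_def stat_sum_def
    by (simp add: sum.If_cases Int_def)
  \<comment> \<open>The second label starts at \<open>r\<close> rather than 0 because of the shift
    in \<open>walks_eq_delayed\<close>.\<close>
  also have "\<dots> = (if k + r \<le> n then real ((p + r) choose r) * path_count (p + r) k (n - k - r) 0 r else 0)"
    by (simp add: graded_sum_eq_walks walks_eq_delayed delayed_eq_path_count)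
  also have "\<dots> = (if k + r \<le> n then real ((p + r) choose r) *
      path_det (n + p - 1) (n + p) (n - 1) (int k) (int (n - k - r)) else 0)"
  proof (cases "k + r \<le> n")
    case True
    then have e: "n - k - r + (p + r) + 0 + k - 1 = n + p - 1" "n - k - r + (p + r) + k = n + p"
      "n - k - r + k + r - 1 = n - 1"
      by auto
    show ?thesis unfolding path_count_def e ..
  qed simp
  finally show ?thesis .
qed

section \<open>The closed form\<close>

lemma det_scale_rows:
  fixes u v w :: real
  assumes "x1 = u * a1" "x2 = u * a2" "x3 = u * a3"
    and "y1 = v * b1" "y2 = v * b2" "y3 = v * b3"
    and "z1 = w * c1" "z2 = w * c2" "z3 = w * c3"
  shows "x1 * (y2 * z3 - y3 * z2) - x2 * (y1 * z3 - y3 * z1) + x3 * (y1 * z2 - y2 * z1) =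
    u * v * w * (a1 * (b2 * c3 - b3 * c2) - a2 * (b1 * c3 - b3 * c1) + a3 * (b1 * c2 - b2 * c1))"
  unfolding assms by (simp add: algebra_simps)

text \<open>By \<open>path_det_eq_rows\<close> the first two rows both consist of neighbours of
  \<open>M choose k\<close>, and by symmetry the third one consists of neighbours of
  \<open>(n - 1) choose t\<close>. Each row is thus a common factor times polynomials.\<close>

lemma path_det_closed_form:
  fixes n k t s M :: nat and q :: real
  assumes n: "n = t + s" "0 < n" and q: "q = real M + 1 - real k"
    and k: "k \<le> t" "n \<le> M + 1"
  shows "path_det M (Suc M) (n - 1) (int k) (int s) =
    (real (M choose k))\<^sup>2 * real (n choose t) / (real n * q\<^sup>2 * (q + 1) * (real k + 1) * (real t + 1)) *
    (q * (q + 1) * ((real k + 1) * q * (real t * (real t + 1)) - (real k + 1) * real k * (real s * (real t + 1)))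
     - real k * (q + 1) * (q * (q - 1) * (real t * (real t + 1)) - (real k + 1) * real k * (real s * (real s - 1)))
     + real k * (real k - 1) * (q * (q - 1) * (real s * (real t + 1)) - (real k + 1) * q * (real s * (real s - 1))))"
proof (cases "k \<le> M")
  case True
  then have pos: "q > 0" using q by simp
  let ?k = "int k" and ?t = "int t"
  let ?B = "real (M choose k)" and ?C = "real (n choose t)"
  \<comment> \<open>The denominators clear the ratios of neighbouring binomials: \<open>q\<close>
    and \<open>q + 1\<close> for lowering \<open>k\<close> twice, \<open>k + 1\<close> for raising
    it, \<open>n\<close> and \<open>t + 1\<close> for the third row, where the entries at
    \<open>t\<close> and \<open>t - 1\<close> add up to \<open>n choose t\<close>.\<close>
  define u where "u = ?B / (q * (q + 1))"
  define v where "v = ?B / (q * (real k + 1))"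
  define w where "w = ?C / (real n * (real t + 1))"
  have B: "binom M ?k = ?B" by (simp add: binom_def)
  have B1: "q * binom M (?k - 1) = real k * ?B"
  proof -
    have "real M - of_int (?k - 1) = q" "of_int (?k - 1) + 1 = real k" using q by simp_all
    then show ?thesis using binom_absorb[of "?k - 1" M] B by simp
  qed
  have B2: "(q + 1) * binom M (?k - 2) = (real k - 1) * binom M (?k - 1)"
  proof -
    have "real M - of_int (?k - 2) = q + 1" "of_int (?k - 2) + 1 = real k - 1" using q by simp_all
    then show ?thesis using binom_absorb[of "?k - 2" M] by simp
  qed
  have B3: "(real k + 1) * binom M (?k + 1) = (q - 1) * ?B"
  proof -
    have "real M - of_int ?k = q - 1" using q by simp
    then show ?thesis using binom_absorb[of ?k M] B by simp
  qed
  have b0: "binom M ?k = u * (q * (q + 1))" "binom M ?k = v * ((real k + 1) * q)"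
    using pos B by (simp_all add: u_def v_def)
  have "binom M (?k - 1) = real k * ?B / q" using B1 pos by (simp add: field_simps)
  then have b1: "binom M (?k - 1) = u * (real k * (q + 1))" "binom M (?k - 1) = v * ((real k + 1) * real k)"
    using pos by (simp_all add: u_def v_def)
  have "binom M (?k - 2) = (real k - 1) * binom M (?k - 1) / (q + 1)"
    using B2 pos by (simp add: field_simps)
  then have b2: "binom M (?k - 2) = u * (real k * (real k - 1))"
    using pos by (simp add: b1)
  have "binom M (?k + 1) = (q - 1) * ?B / (real k + 1)" using B3 by (simp add: field_simps)
  then have b3: "binom M (?k + 1) = v * (q * (q - 1))"
    using pos by (simp add: v_def)
  define z where "z = n - 1"
  have z: "Suc z = n" "real z = real t + real s - 1" using n by (simp add: z_def, simp add: z_def, linarith)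
  have C: "binom z ?t + binom z (?t - 1) = ?C"
    using binom_Suc[of z ?t] z by (simp add: binom_def)
  have C1: "real t * binom z ?t = real s * binom z (?t - 1)"
  proof -
    have "real z - of_int (?t - 1) = real s" "of_int (?t - 1) + 1 = real t" using z(2) by simp_all
    then show ?thesis using binom_absorb[of "?t - 1" z] by simp
  qed
  have C2: "(real t + 1) * binom z (?t + 1) = (real s - 1) * binom z ?t"
  proof -
    have "real z - of_int ?t = real s - 1" using z(2) by simp
    then show ?thesis using binom_absorb[of ?t z] by simp
  qed
  have np: "real n = real t + real s" "real n > 0" using n by (simp, linarith)
  have "real n * binom z (?t - 1) = real t * ?C" "real n * binom z ?t = real s * ?C"
    using C1 unfolding np(1) C[symmetric] by (simp_all add: algebra_simps)
  then have c: "binom z (?t - 1) = real t * ?C / real n" "binom z ?t = real s * ?C / real n"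
    using np(2) by (metis nonzero_mult_div_cancel_left less_irrefl)+
  have c1: "binom z (?t - 1) = w * (real t * (real t + 1))" "binom z ?t = w * (real s * (real t + 1))"
    using np(2) by (simp_all add: c w_def)
  have "binom z (?t + 1) = (real s - 1) * binom z ?t / (real t + 1)"
    using C2 by (simp add: field_simps)
  then have c3: "binom z (?t + 1) = w * (real s * (real s - 1))"
    by (simp add: c1)
  have sym: "?t + int s = int z + 1" using n z(1) by simp
  have "path_det M (Suc M) z ?k (int s) = path_det M M z ?k (int s)" by (rule path_det_eq_rows)
  also have "\<dots> = u * v * w *
    (q * (q + 1) * ((real k + 1) * q * (real t * (real t + 1)) - (real k + 1) * real k * (real s * (real t + 1)))
     - real k * (q + 1) * (q * (q - 1) * (real t * (real t + 1)) - (real k + 1) * real k * (real s * (real s - 1)))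
     + real k * (real k - 1) * (q * (q - 1) * (real s * (real t + 1)) - (real k + 1) * q * (real s * (real s - 1))))"
    unfolding path_det_def binom_symmetric_row[OF sym]
    by (rule det_scale_rows) (fact b0 b1 b2 b3 c1 c3)+
  also have "u * v * w = ?B\<^sup>2 * ?C / (real n * q\<^sup>2 * (q + 1) * (real k + 1) * (real t + 1))"
    by (simp add: u_def v_def w_def power2_eq_square ac_simps)
  finally show ?thesis unfolding z_def .
next
  case False
  \<comment> \<open>Here \<open>M < k \<le> t \<le> n \<le> M + 1\<close> forces
    \<open>k = t = n = M + 1\<close>, and both sides vanish.\<close>
  then have "s = 0" "M choose k = 0" "binom M (int k) = 0" "binom M (int k + 1) = 0"
    using k n by (auto simp: binom_def nat_add_distrib)
  then show ?thesis unfolding path_det_eq_rows by (simp add: path_det_def)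
qed

theorem theorem2:
  fixes n k p r :: nat and q s t :: real
  assumes "n > 0"
    and "q = real n + real p - real k"
    and "s = real n - real k - real r"
    and "t = real k + real r"
  shows "real (num_involutive_baxter n k p r) =
    real ((p + r) choose r) * (real ((n + p - 1) choose k))\<^sup>2 * real (n choose (k + r))
      / (real n * q\<^sup>2 * (q + 1) * (real k + 1) * (t + 1))
    * det (vector
        [vector [q * (q + 1), q * (q - 1), s * (s - 1)],
         vector [real k * (q + 1), (real k + 1) * q, s * (t + 1)],
         vector [real k * (real k - 1), real k * (real k + 1), t * (t + 1)]] :: real ^ 3 ^ 3)"
proof (cases "k + r \<le> n")
  case True
  have t: "t = real (k + r)" and s: "s = real (n - k - r)" using assms True by auto
  have q: "q = real (n + p - 1) + 1 - real k" using assms by (simp add: of_nat_diff)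
  have n_le: "n \<le> n + p - 1 + 1" by simp
  have "n + p = Suc (n + p - 1)" "n = (k + r) + (n - k - r)" using assms True by auto
  then have "real (num_involutive_baxter n k p r) =
      real ((p + r) choose r) * path_det (n + p - 1) (Suc (n + p - 1)) (n - 1) (int k) (int (n - k - r))"
    using True by (simp add: num_involutive_baxter_eq)
  also note path_det_closed_form[OF \<open>n = (k + r) + (n - k - r)\<close> assms(1) q le_add1 n_le]
  \<comment> \<open>The matrix in the theorem is the transpose of the one expanded in
    \<open>path_det_closed_form\<close>.\<close>
  finally show ?thesis
    unfolding t[symmetric] s[symmetric] by (simp add: det_3 algebra_simps)
next
  case False
  \<comment> \<open>The right-hand side vanishes through \<open>n choose (k + r)\<close>.\<close>
  then show ?thesis by (simp add: num_involutive_baxter_eq)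
qed

end
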